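(* Let $1<p<\infty$, $0<\beta<1$, and $0<Q<\infty$ be such that $Q>\beta p$. Assume that $X=(X,d,\mu)$ is a complete and connected metric space equipped with an Ahlfors $Q$-regular measure $\mu$. Then there is a constant $C>0$ such that $$C^{-1}\, R_{\beta,p}(E\cap \overline{B(x,r)}) \leq \operatorname{cap}_{\beta,p}\big(E\cap \overline{B(x,r)},B(x,2r)\big)\le C\, R_{\beta,p}(E\cap \overline{B(x,r)})$$ whenever $E\subset X$ is a closed set, $x\in E$ and $0<r<(1/8)\operatorname{diam}(X)$.
   Context: Standing assumptions: $X=(X,d,\mu)$ is a metric measure space with at least two points, equipped with a metric $d$ and a positive complete Borel measure $\mu$ such that $0<\mu(B)<\infty$ for all balls $B\subset X$. Balls are open, $B(x,r)=\{y\in X: d(y,x)<r\}$, and $\overline{B(x,r)}$ denotes the closure. The measure $\mu$ is doubling: there is $c_\mu>1$ with $\mu(B(x,2r))\le c_\mu\,\mu(B(x,r))$ for all $x\in X$, $r>0$. $\operatorname{diam}(X)$ may be $\infty$. Ahlfors $Q$-regular: there is a constant $c_Q\ge 1$ such that $c_Q^{-1}r^Q\le\mu(B(x,r))\le c_Q r^Q$ for all $x\in X$ and all $0<r<\operatorname{diam}(X)$. Riesz potential and Riesz capacity: for a nonnegative measurable function $f$ on $X$ and $\beta>0$, $$I_\beta f(x)=\int_X \frac{f(y)\,d(x,y)^\beta}{\mu(B(x,d(x,y)))}\,d\mu(y),\qquad x\in X.$$ For $F\subset X$ and $p\ge1$, $R_{\beta,p}(F)=\inf\{\|f\|_{L^p(X)}^p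 : f\ge 0 \text{ and } I_\beta f\ge 1 \text{ on } F\}$. Hajłasz gradients and capacity: $\operatorname{Lip}_\beta(X)$ is the set of all $u\colon X\to\mathbb{R}$ for which there is $0\le\kappa<\infty$ with $|u(x)-u(y)|\le\kappa\, d(x,y)^\beta$ for all $x,y\in X$. For $u\colon X\to\mathbb{R}$, $\mathcal{D}_H^\beta(u)$ is the family of all measurable $g\colon X\to[0,\infty]$ for which there is a set $N\subset X$ with $\mu(N)=0$ such that $|u(x)-u(y)|\le d(x,y)^\beta(g(x)+g(y))$ for all $x,y\in X\setminus N$. For $1\le p<\infty$, $0<\beta\le1$, a bounded open set $\Omega\subset X$ and a closed subset $F\subset\Omega$, $$\operatorname{cap}_{\beta,p}(F,\Omega)=\inf_u\inf_g\int_X g(x)^p\,d\mu(x),$$ where the infimums are over all $u\in\operatorname{Lip}_\beta(X)$ with $u\ge1$ in $F$ and $u=0$ in $X\setminus\Omega$, and all $g\in\mathcal{D}_H^\beta(u)$; if no such $u$ exists, $\operatorname{cap}_{\beta,p}(F,\Omega)=\infty$. *)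

theory Defs
  imports "HOL-Analysis.Analysis"
begin

text \<open>
  The metric space X is the whole type, with distance \<open>dist\<close>. The measure is only required to be
  defined on the Borel sets and to be complete, so its \<open>\<sigma>\<close>-algebra may be larger than the Borel one.
\<close>

locale metric_measure_space = complete_measure M
  for M :: "'a::metric_space measure" +
  assumes two_points: "\<exists>x y :: 'a. x \<noteq> y"
    and space_UNIV: "space M = UNIV"
    and borel_sets: "sets borel \<subseteq> sets M"
    and ball_positive: "r > 0 \<Longrightarrow> 0 < emeasure M (ball x r)"
    and ball_finite: "r > 0 \<Longrightarrow> emeasure M (ball x r) < \<infinity>"

definition doubling :: "'a::metric_space measure \<Rightarrow> bool" where
  "doubling M \<longleftrightarrow>
    (\<exists>c::real. c > 1 \<and>
      (\<forall>x r. r > 0 \<longrightarrow> emeasure M (ball x (2 * r)) \<le> ennreal c * emeasure M (ball x r)))"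

text \<open>The library's \<open>diameter\<close> is 0 on unbounded sets; here the diameter is \<open>\<infinity>\<close> in that case.\<close>

definition ediameter :: "'a::metric_space set \<Rightarrow> ennreal" where
  "ediameter S = (SUP x\<in>S. SUP y\<in>S. ennreal (dist x y))"

definition ahlfors_regular :: "real \<Rightarrow> 'a::metric_space measure \<Rightarrow> bool" where
  "ahlfors_regular Q M \<longleftrightarrow>
    (\<exists>c::real. c \<ge> 1 \<and>
      (\<forall>x r. 0 < r \<and> ennreal r < ediameter (UNIV :: 'a set) \<longrightarrow>
        ennreal (inverse c * r powr Q) \<le> emeasure M (ball x r) \<and>
        emeasure M (ball x r) \<le> ennreal (c * r powr Q)))"

text \<open>Real powers on \<open>[0,\<infinity>]\<close>, meant for exponents \<open>p > 0\<close>.\<close>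

definition ennreal_powr :: "ennreal \<Rightarrow> real \<Rightarrow> ennreal" where
  "ennreal_powr t p = (if t = \<infinity> then \<infinity> else ennreal (enn2real t powr p))"

text \<open>
  At \<open>y = x\<close> the integrand below is \<open>0 / 0 = 0\<close>; this is immaterial whenever points have measure
  zero, in particular for Ahlfors regular measures on connected spaces with at least two points.
\<close>

definition riesz_potential ::
    "'a::metric_space measure \<Rightarrow> real \<Rightarrow> ('a \<Rightarrow> ennreal) \<Rightarrow> 'a \<Rightarrow> ennreal" where
  "riesz_potential M \<beta> f x =
    (\<integral>\<^sup>+ y. f y * ennreal (dist x y powr \<beta>) / emeasure M (ball x (dist x y)) \<partial>M)"

definition riesz_capacity ::
    "'a::metric_space measure \<Rightarrow> real \<Rightarrow> real \<Rightarrow> 'a set \<Rightarrow> ennreal" where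
  "riesz_capacity M \<beta> p F =
    (INF f \<in> {f \<in> borel_measurable M. \<forall>x\<in>F. 1 \<le> riesz_potential M \<beta> f x}.
      \<integral>\<^sup>+ y. ennreal_powr (f y) p \<partial>M)"

definition Lip :: "real \<Rightarrow> ('a::metric_space \<Rightarrow> real) set" where
  "Lip \<beta> = {u. \<exists>\<kappa>\<ge>0. \<forall>x y. \<bar>u x - u y\<bar> \<le> \<kappa> * dist x y powr \<beta>}"

definition hajlasz_gradients ::
    "'a::metric_space measure \<Rightarrow> real \<Rightarrow> ('a \<Rightarrow> real) \<Rightarrow> ('a \<Rightarrow> ennreal) set" where
  "hajlasz_gradients M \<beta> u =
    {g \<in> borel_measurable M. \<exists>N \<in> null_sets M. \<forall>x \<in> - N. \<forall>y \<in> - N.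
      ennreal \<bar>u x - u y\<bar> \<le> ennreal (dist x y powr \<beta>) * (g x + g y)}"

text \<open>
  Intended for a bounded open set \<open>\<Omega>\<close> and a closed set \<open>F \<subseteq> \<Omega>\<close>. Infima in \<^typ>\<open>ennreal\<close> over
  the empty set are \<open>\<infinity>\<close>, which covers the case without admissible functions.
\<close>

definition hajlasz_capacity ::
    "'a::metric_space measure \<Rightarrow> real \<Rightarrow> real \<Rightarrow> 'a set \<Rightarrow> 'a set \<Rightarrow> ennreal" where
  "hajlasz_capacity M \<beta> p F \<Omega> =
    (INF u \<in> {u \<in> Lip \<beta>. (\<forall>x\<in>F. 1 \<le> u x) \<and> (\<forall>x \<in> - \<Omega>. u x = 0)}.
      INF g \<in> hajlasz_gradients M \<beta> u. \<integral>\<^sup>+ x. ennreal_powr (g x) p \<partial>M)"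

end

theory Submission
  imports Defs
begin

text \<open>
  Lower bound on the Hajlasz capacity: if \<open>u\<close> is admissible with gradient \<open>g\<close>, then telescoping over balls
  shrinking to \<open>y\<close> and using that \<open>u\<close> vanishes on a ball of radius \<open>r\<close> near \<open>B(x, 2r)\<close> gives
  \<open>u y \<le> C I\<^sub>\<beta> g y\<close>, so \<open>C g\<close> competes for the Riesz capacity.

  Upper bound: let \<open>I\<^sub>\<beta> f \<ge> 1\<close> on \<open>F\<close>. If \<open>\<integral> f\<^sup>p\<close> exceeds a small multiple of \<open>r\<^bsup>Q - \<beta>p\<^esup>\<close>, a cutoff function of \<open>B(x, r)\<close>
  does the job. Otherwise, because \<open>\<beta>p < Q\<close>, the scales larger than \<open>r / 8\<close> contribute at most \<open>1 / 2\<close> to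
  \<open>I\<^sub>\<beta> f\<close>, and the contribution of the smaller scales is comparable to a sum over \<open>i\<close> of
  \<open>s\<^bsup>\<beta> - Q\<^esup> \<integral> f(w) bump(d(y,w) / s) dw\<close> with \<open>s = (r / 8) / 2^i\<close>, where \<open>f\<close> may be cut off outside
  \<open>B(x, 3r / 2)\<close>. Each summand is Lipschitz, so each partial sum \<open>u\<close> lies in \<open>Lip \<beta>\<close>; since \<open>\<beta> < 1\<close> the
  differences add up to \<open>\<bar>u y - u z\<bar> \<le> C d(y,z)\<^sup>\<beta> (Mf y + Mf z)\<close> with \<open>Mf\<close> the maximal function, whose
  \<open>L\<^sup>p\<close> bound follows from a covering lemma. The partial sums increase and \<open>F\<close> is compact, so finitely many
  scales suffice.
\<close>

section \<open>Real and extended nonnegative numbers\<close>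

text \<open>The quantity r^(Q - \<beta>p) is the energy scale of the cutoff of B(x, r), so a
  competitor f of larger energy loses to that cutoff. At the other end infinitely many scales would
  destroy membership in Lip \<beta>, since the potential of an L^p function may be unbounded; the
  gradient bound must therefore not depend on the number of scales. The condition \<beta> < 1 enters
  through the bound of the sum over scales s of s^\<beta> min(1, d/s) by C d^\<beta>; for \<beta> =
  1 each scale above d would contribute the same amount d. In the lower bound the geometry of X
  supplies the zeros of u: as r is below an eighth of the diameter, some point is farther than 4r
  from x, connectedness gives a point z at distance exactly 3r, and u vanishes on B(z, r).
  Differences are kept in the additive form a \<le> b + c, because f and g may be infinite.\<close>

lemma sum_power_inj_le:
  fixes q :: real and h :: "'b \<Rightarrow> nat"
  assumes "0 < q" "q < 1" "finite I" "inj_on h I"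
  shows "(\<Sum>i\<in>I. q ^ h i) \<le> 1 / (1 - q)"
proof -
  have "(\<Sum>i\<in>I. q ^ h i) = (\<Sum>j\<in>h ` I. q ^ j)"
    using assms by (simp add: sum.reindex)
  also have "\<dots> \<le> (\<Sum>j. q ^ j)"
    using assms by (intro sum_le_suminf summable_geometric) auto
  also have "\<dots> = 1 / (1 - q)"
    using assms by (simp add: suminf_geometric)
  finally show ?thesis .
qed

text \<open>The largest scale dominates geometrically. The index set may have gaps because scales
  are selected by comparison with a distance.\<close>

lemma sum_dyadic_le:
  fixes \<rho> \<gamma> d :: real
  assumes "0 < \<rho>" "0 < \<gamma>" "0 \<le> d" "finite I" "\<And>i. i \<in> I \<Longrightarrow> \<rho> / 2 ^ i \<le> d"
  shows "(\<Sum>i\<in>I. (\<rho> / 2 ^ i) powr \<gamma>) \<le> d powr \<gamma> / (1 - 2 powr (-\<gamma>))"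
proof (cases "I = {}")
  case True
  then show ?thesis using assms by (simp add: powr_le_one_le powr_minus divide_simps)
next
  case False
  define m where "m = Min I"
  have m: "m \<in> I" "\<And>i. i \<in> I \<Longrightarrow> m \<le> i" using False assms by (auto simp: m_def)
  have q: "2 powr (-\<gamma>) < (1::real)" using assms by (simp add: powr_less_one)
  have eq: "(\<rho> / 2 ^ i) powr \<gamma> = (\<rho> / 2 ^ m) powr \<gamma> * (2 powr (-\<gamma>)) ^ (i - m)" if "i \<in> I" for i
  proof -
    have "\<rho> / 2 ^ i = (\<rho> / 2 ^ m) * (2 powr (- real (i - m)))"
      using m(2)[OF that] by (simp add: powr_minus powr_realpow field_simps del: of_nat_diff flip: power_add)
    then have "(\<rho> / 2 ^ i) powr \<gamma> = (\<rho> / 2 ^ m) powr \<gamma> * (2 powr (- real (i - m))) powr \<gamma>"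
      by (simp only: powr_mult)
    then show ?thesis by (simp add: powr_powr powr_power mult.commute)
  qed
  have "(\<Sum>i\<in>I. (\<rho> / 2 ^ i) powr \<gamma>) = (\<rho> / 2 ^ m) powr \<gamma> * (\<Sum>i\<in>I. (2 powr (-\<gamma>)) ^ (i - m))"
    by (simp add: eq sum_distrib_left)
  also have "\<dots> \<le> d powr \<gamma> * (1 / (1 - 2 powr (-\<gamma>)))"
    using assms m q
    by (intro mult_mono sum_power_inj_le powr_mono2 inj_onI sum_nonneg) (auto simp: eq_diff_iff)
  finally show ?thesis by simp
qed

text \<open>Mirror image: with a negative exponent the smallest scale dominates, hence
  \<open>Max I\<close>.\<close>

lemma sum_dyadic_ge:
  fixes \<rho> \<gamma> d :: real
  assumes "0 < d" "0 < \<gamma>" "finite I" "\<And>i. i \<in> I \<Longrightarrow> d \<le> \<rho> / 2 ^ i"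
  shows "(\<Sum>i\<in>I. (\<rho> / 2 ^ i) powr (-\<gamma>)) \<le> d powr (-\<gamma>) / (1 - 2 powr (-\<gamma>))"
proof (cases "I = {}")
  case True
  then show ?thesis using assms by (simp add: powr_le_one_le powr_minus divide_simps)
next
  case False
  define m where "m = Max I"
  have m: "m \<in> I" "\<And>i. i \<in> I \<Longrightarrow> i \<le> m" using False assms by (auto simp: m_def)
  have "0 < \<rho> / 2 ^ m" using assms(1) assms(4)[OF m(1)] by linarith
  then have \<rho>: "0 < \<rho>" by (simp add: zero_less_divide_iff)
  have q: "2 powr (-\<gamma>) < (1::real)" using assms by (simp add: powr_less_one)
  have eq: "(\<rho> / 2 ^ i) powr (-\<gamma>) = (\<rho> / 2 ^ m) powr (-\<gamma>) * (2 powr (-\<gamma>)) ^ (m - i)" if "i \<in> I" for i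
  proof -
    have "\<rho> / 2 ^ i = (\<rho> / 2 ^ m) * (2 powr (real (m - i)))"
      using m(2)[OF that] by (simp add: powr_realpow field_simps del: of_nat_diff flip: power_add)
    then have "(\<rho> / 2 ^ i) powr (-\<gamma>) = (\<rho> / 2 ^ m) powr (-\<gamma>) * (2 powr (real (m - i))) powr (-\<gamma>)"
      by (simp only: powr_mult)
    then show ?thesis by (simp add: powr_powr powr_power mult.commute)
  qed
  have inj: "inj_on (\<lambda>i. m - i) I"
    by (rule inj_onI) (metis m(2) diff_diff_cancel)
  have "(\<Sum>i\<in>I. (\<rho> / 2 ^ i) powr (-\<gamma>)) = (\<rho> / 2 ^ m) powr (-\<gamma>) * (\<Sum>i\<in>I. (2 powr (-\<gamma>)) ^ (m - i))"
    by (simp add: eq sum_distrib_left)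
  also have "\<dots> \<le> d powr (-\<gamma>) * (1 / (1 - 2 powr (-\<gamma>)))"
    using assms m q \<rho> inj
    by (intro mult_mono sum_power_inj_le powr_mono2' sum_nonneg) auto
  finally show ?thesis by simp
qed

section \<open>Powers of extended nonnegative numbers\<close>

lemma ennreal_powr_mult:
  assumes "0 < c" "0 < p"
  shows "ennreal_powr (ennreal c * t) p = ennreal (c powr p) * ennreal_powr t p"
proof (cases t)
  case (real a)
  then show ?thesis using assms
    by (simp add: ennreal_powr_def powr_mult flip: ennreal_mult)
next
  case top
  then show ?thesis using assms by (simp add: ennreal_powr_def ennreal_mult_top)
qed

lemma ennreal_powr_0 [simp]: "0 < p \<Longrightarrow> ennreal_powr 0 p = 0"
  by (simp add: ennreal_powr_def)

lemma ennreal_powr_ennreal: "0 \<le> a \<Longrightarrow> ennreal_powr (ennreal a) p = ennreal (a powr p)"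
  by (simp add: ennreal_powr_def)

lemma ennreal_powr_mono:
  assumes "s \<le> t" "0 < p" shows "ennreal_powr s p \<le> ennreal_powr t p"
proof (cases t)
  case (real b)
  then obtain a where "s = ennreal a" "0 \<le> a" using assms(1) by (cases s) (auto simp: top_unique)
  then show ?thesis using assms real by (auto simp: ennreal_powr_ennreal intro!: ennreal_leI powr_mono2)
qed (simp add: ennreal_powr_def)

lemma measurable_ennreal_powr [measurable]:
  assumes [measurable]: "f \<in> borel_measurable M"
  shows "(\<lambda>y. ennreal_powr (f y) p) \<in> borel_measurable M"
  unfolding ennreal_powr_def by measurable

text \<open>Greedy selection: a ball of largest radius, once tripled, swallows every ball that meets
  it; recurse on the balls disjoint from it.\<close>

lemma finite_disjoint_balls:
  fixes c :: "'i \<Rightarrow> 'a::metric_space"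
  assumes "finite I" "\<And>k. k \<in> I \<Longrightarrow> 0 < q k"
  shows "\<exists>J\<subseteq>I. disjoint_family_on (\<lambda>k. ball (c k) (q k)) J \<and>
    (\<Union>k\<in>I. ball (c k) (q k)) \<subseteq> (\<Union>k\<in>J. ball (c k) (3 * q k))"
  using assms
proof (induction I rule: finite_psubset_induct)
  case (psubset I)
  show ?case
  proof (cases "I = {}")
    case False
    then have "Max (q ` I) \<in> q ` I" using psubset.hyps by (intro Max_in) auto
    then obtain m where "m \<in> I" "Max (q ` I) = q m" by auto
    then have m: "m \<in> I" "\<And>k. k \<in> I \<Longrightarrow> q k \<le> q m"
      using psubset.hyps by (auto intro: Max_ge simp flip: \<open>Max (q ` I) = q m\<close>)
    define I' where "I' = {k \<in> I. ball (c k) (q k) \<inter> ball (c m) (q m) = {}}"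
    have "c m \<in> ball (c m) (q m)" using psubset.prems[OF m(1)] by simp
    then have "m \<notin> I'" unfolding I'_def by blast
    moreover have "I' \<subseteq> I" by (auto simp: I'_def)
    ultimately have "I' \<subset> I" using m(1) by blast
    then obtain J where J: "J \<subseteq> I'" "disjoint_family_on (\<lambda>k. ball (c k) (q k)) J"
      "(\<Union>k\<in>I'. ball (c k) (q k)) \<subseteq> (\<Union>k\<in>J. ball (c k) (3 * q k))"
      using psubset.IH[of I'] psubset.prems by blast
    have "ball (c k) (q k) \<subseteq> ball (c m) (3 * q m)" if k: "k \<in> I" "k \<notin> I'" for k
    proof -
      obtain z where z: "dist (c k) z < q k" "dist (c m) z < q m" using k by (auto simp: I'_def)
      show ?thesis
      proof
        fix w assume "w \<in> ball (c k) (q k)"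
        then show "w \<in> ball (c m) (3 * q m)"
          using z m(2)[OF k(1)] dist_triangle2[of "c m" "c k" z] dist_triangle[of "c m" w "c k"] by simp
      qed
    qed
    then have "ball (c k) (q k) \<subseteq> (\<Union>k\<in>insert m J. ball (c k) (3 * q k))" if "k \<in> I" for k
      using J(3) that by (cases "k \<in> I'") blast+
    then have "(\<Union>k\<in>I. ball (c k) (q k)) \<subseteq> (\<Union>k\<in>insert m J. ball (c k) (3 * q k))"
      by blast
    moreover have "disjoint_family_on (\<lambda>k. ball (c k) (q k)) (insert m J)"
      using J(1,2) \<open>m \<notin> I'\<close> unfolding I'_def disjoint_family_on_def by blast
    ultimately show ?thesis using J(1) m(1) \<open>I' \<subset> I\<close> by (intro exI[of _ "insert m J"]) auto
  qed (auto simp: disjoint_family_on_def)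
qed

lemma two_mult_ennreal: "0 \<le> b \<Longrightarrow> 2 * ennreal b = ennreal (2 * b)"
  by (simp add: ennreal_mult')

section \<open>Layer-cake integrals\<close>

lemma nn_integral_powr_Ioo:
  assumes "-1 < a" "0 \<le> b"
  shows "(\<integral>\<^sup>+\<tau>. ennreal (\<tau> powr a) * indicator {0<..<b} \<tau> \<partial>lborel) = ennreal (b powr (a + 1) / (a + 1))"
proof -
  have "((\<lambda>x. x powr a) has_integral (b powr (a + 1) / (a + 1))) {0<..<b}"
    using has_integral_powr_from_0[OF assms] by (simp add: has_integral_Icc_iff_Ioo)
  then show ?thesis by (intro nn_integral_has_integral_lebesgue') auto
qed

lemma ennreal_powr_le_layer:
  assumes "0 < p"
  shows "ennreal_powr t p \<le>
    (\<integral>\<^sup>+\<tau>. ennreal (p * \<tau> powr (p - 1)) * indicator {\<tau>. 0 < \<tau> \<and> ennreal \<tau> < t} \<tau> \<partial>lborel)"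
    (is "_ \<le> ?I t")
proof -
  have fin: "ennreal_powr (ennreal b) p \<le> ?I t" if "0 \<le> b" "ennreal b \<le> t" for b
  proof -
    have "ennreal_powr (ennreal b) p = ennreal p * (\<integral>\<^sup>+\<tau>. ennreal (\<tau> powr (p - 1)) * indicator {0<..<b} \<tau> \<partial>lborel)"
      using nn_integral_powr_Ioo[of "p - 1" b] assms that
      by (simp add: ennreal_powr_ennreal flip: ennreal_mult)
    also have "\<dots> = (\<integral>\<^sup>+\<tau>. ennreal (p * \<tau> powr (p - 1)) * indicator {0<..<b} \<tau> \<partial>lborel)"
      using assms by (subst nn_integral_cmult[symmetric]) (auto simp: ennreal_mult mult.assoc)
    also have "\<dots> \<le> ?I t"
    proof (intro nn_integral_mono mult_left_mono)
      fix \<tau> :: real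
      have "ennreal \<tau> < t" if "0 < \<tau>" "\<tau> < b"
        using that \<open>ennreal b \<le> t\<close> ennreal_lessI[of b \<tau>] by (auto intro: less_le_trans)
      then show "indicator {0<..<b} \<tau> \<le> (indicator {\<tau>. 0 < \<tau> \<and> ennreal \<tau> < t} \<tau> :: ennreal)"
        by (simp add: indicator_def)
    qed auto
    finally show ?thesis .
  qed
  show ?thesis
  proof (cases t)
    case (real b) then show ?thesis using fin by simp
  next
    case top
    \<comment> \<open>For \<open>t = top\<close> every positive level counts; truncating at the
      height \<open>n powr (1 / p)\<close> already yields the value n.\<close>
    have "of_nat n \<le> ?I t" for n
    proof -
      have "of_nat n = ennreal_powr (ennreal (real n powr (1 / p))) p"
        using assms by (simp add: ennreal_powr_ennreal powr_powr ennreal_of_nat_eq_real_of_nat)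
      also have "\<dots> \<le> ?I t" using top by (intro fin) auto
      finally show ?thesis .
    qed
    then have "\<not> ?I t < top"
      using ennreal_Ex_less_of_nat[of "?I t"] by (auto simp: not_le[symmetric])
    then have "?I t = top" by (simp add: less_top[symmetric])
    then show ?thesis by simp
  qed
qed

text \<open>This is the level integral that remains once a weak-type bound has used up one factor
  \<tau> of the layer-cake weight. \<open>1 < p\<close> makes \<open>\<tau> powr (p - 2)\<close>
  integrable at 0, and the limit \<open>2 * t\<close> comes from truncating f at height \<tau> /
  2.\<close>

lemma layer_le_ennreal_powr:
  assumes "1 < p"
  shows "t * (\<integral>\<^sup>+\<tau>. ennreal (p * \<tau> powr (p - 2)) * indicator {\<tau>. 0 < \<tau> \<and> ennreal \<tau> < 2 * t} \<tau> \<partial>lborel)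
    \<le> ennreal (p / (p - 1) * 2 powr (p - 1)) * ennreal_powr t p" (is "t * ?I \<le> _")
proof (cases t)
  case (real b)
  have "?I \<le> (\<integral>\<^sup>+\<tau>. ennreal p * (ennreal (\<tau> powr (p - 2)) * indicator {0<..<2 * b} \<tau>) \<partial>lborel)"
    using real assms
  proof (intro nn_integral_mono)
    fix \<tau> :: real
    have "ennreal \<tau> < 2 * t \<longleftrightarrow> \<tau> < 2 * b" if "0 < \<tau>"
      using that real by (simp add: two_mult_ennreal ennreal_less_iff)
    then show "ennreal (p * \<tau> powr (p - 2)) * indicator {\<tau>. 0 < \<tau> \<and> ennreal \<tau> < 2 * t} \<tau>
      \<le> ennreal p * (ennreal (\<tau> powr (p - 2)) * indicator {0<..<2 * b} \<tau>)"
      using assms by (cases "0 < \<tau> \<and> \<tau> < 2 * b") (auto simp: ennreal_mult)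
  qed
  also have "\<dots> = ennreal p * ennreal ((2 * b) powr (p - 1) / (p - 1))"
    using assms real nn_integral_powr_Ioo[of "p - 2" "2 * b"] by (subst nn_integral_cmult) (auto simp: algebra_simps)
  finally have "t * ?I \<le> ennreal b * (ennreal p * ennreal ((2 * b) powr (p - 1) / (p - 1)))"
    using real by (auto intro: mult_left_mono)
  also have "\<dots> = ennreal (b * (p * ((2 * b) powr (p - 1) / (p - 1))))"
    using assms real by (simp flip: ennreal_mult)
  also have "b * (p * ((2 * b) powr (p - 1) / (p - 1))) = p / (p - 1) * 2 powr (p - 1) * (b powr p)"
    using real assms by (cases "b = 0") (auto simp: powr_mult powr_diff field_simps)
  also have "ennreal \<dots> = ennreal (p / (p - 1) * 2 powr (p - 1)) * ennreal_powr t p"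
    using real assms by (subst ennreal_mult) (auto simp: ennreal_powr_ennreal)
  finally show ?thesis .
next
  case top
  then show ?thesis using assms by (simp add: ennreal_powr_def ennreal_mult_top)
qed

lemma ennreal_add_mult: "0 \<le> a \<Longrightarrow> 0 \<le> b \<Longrightarrow> ennreal (a + b) * t = ennreal a * t + ennreal b * t"
  by (simp add: distrib_right)

lemma tendsto_dyadic_powr:
  assumes "0 < \<beta>" "0 < \<rho>"
  shows "(\<lambda>n. \<kappa> * (\<rho> / 2 ^ n) powr \<beta>) \<longlonglongrightarrow> (0::real)"
proof -
  have "(\<lambda>n. \<rho> / 2 ^ n) \<longlonglongrightarrow> 0" by (rule LIMSEQ_divide_realpow_zero) simp
  then have "(\<lambda>n. (\<rho> / 2 ^ n) powr \<beta>) \<longlonglongrightarrow> 0 powr \<beta>"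
    using assms by (intro tendsto_powr2) auto
  then show ?thesis using tendsto_mult_left[of _ 0 _ \<kappa>] by simp
qed

text \<open>Split at the scale d. Scales up to d contribute at most s^\<beta> and the largest
  dominates; those above contribute at most d s^(\<beta> - 1) and, as \<beta> < 1, the smallest
  dominates. Both parts are of order d^\<beta>.\<close>

lemma sum_dyadic_min_le:
  fixes \<rho> \<beta> d :: real
  assumes "0 < \<rho>" "0 < \<beta>" "\<beta> < 1" "0 \<le> d"
  shows "(\<Sum>i<n. (\<rho> / 2 ^ i) powr \<beta> * min 1 (d / (\<rho> / 2 ^ i)))
    \<le> (1 / (1 - 2 powr (-\<beta>)) + 1 / (1 - 2 powr (\<beta> - 1))) * d powr \<beta>"
proof (cases "d = 0")
  case False
  then have d: "0 < d" using assms by simp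
  let ?s = "\<lambda>i. \<rho> / 2 ^ i :: real"
  let ?I = "{i. i < n \<and> ?s i \<le> d}" and ?J = "{i. i < n \<and> \<not> ?s i \<le> d}"
  have s: "0 < ?s i" for i using assms by simp
  have "(\<Sum>i<n. ?s i powr \<beta> * min 1 (d / ?s i)) =
      (\<Sum>i\<in>?I. ?s i powr \<beta> * min 1 (d / ?s i)) + (\<Sum>i\<in>?J. ?s i powr \<beta> * min 1 (d / ?s i))"
    by (subst sum.union_disjoint[symmetric]) (auto intro!: sum.cong)
  also have "\<dots> \<le> (\<Sum>i\<in>?I. ?s i powr \<beta>) + (\<Sum>i\<in>?J. d * ?s i powr (-(1 - \<beta>)))"
  proof (intro add_mono sum_mono)
    fix i
    show "?s i powr \<beta> * min 1 (d / ?s i) \<le> ?s i powr \<beta>"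
      by (rule mult_left_le) auto
    have "?s i powr \<beta> * min 1 (d / ?s i) \<le> ?s i powr \<beta> * (d / ?s i)"
      by (intro mult_left_mono) auto
    also have "\<dots> = d * ?s i powr (-(1 - \<beta>))"
      using powr_diff[of "?s i" \<beta> 1] s[of i] assms(1) by simp
    finally show "?s i powr \<beta> * min 1 (d / ?s i) \<le> d * ?s i powr (-(1 - \<beta>))" .
  qed
  also have "\<dots> \<le> d powr \<beta> / (1 - 2 powr (-\<beta>)) + d * (d powr (-(1 - \<beta>)) / (1 - 2 powr (-(1 - \<beta>))))"
    unfolding sum_distrib_left[symmetric] using assms d
    by (intro add_mono mult_left_mono sum_dyadic_le sum_dyadic_ge) auto
  also have "d * (d powr (-(1 - \<beta>)) / (1 - 2 powr (-(1 - \<beta>)))) = d powr \<beta> / (1 - 2 powr (\<beta> - 1))"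
    using d powr_add[of d 1 "\<beta> - 1"] by simp
  finally show ?thesis by (simp add: field_simps)
qed simp

text \<open>Distances up to 1 use the Lipschitz bound and d \<le> d^\<beta>, larger ones the sup
  bound and 1 \<le> d^\<beta>.\<close>

lemma bounded_Lipschitz_in_Lip:
  assumes "0 < \<beta>" "\<beta> \<le> 1" "\<And>y. \<bar>u y\<bar> \<le> B" "\<And>y z. \<bar>u y - u z\<bar> \<le> L * dist y z"
  shows "u \<in> Lip \<beta>"
proof -
  have "\<bar>u y - u z\<bar> \<le> (\<bar>L\<bar> + 2 * B) * dist y z powr \<beta>" for y z
  proof -
    have B: "0 \<le> B" using assms(3)[of y] by linarith
    show ?thesis
    proof (cases "dist y z \<le> 1")
      case True
      have "dist y z \<le> dist y z powr \<beta>"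
        using powr_mono'[of \<beta> 1 "dist y z"] True assms by simp
      have "\<bar>u y - u z\<bar> \<le> \<bar>L\<bar> * dist y z"
        using assms(4)[of y z] mult_right_mono[OF abs_ge_self[of L], of "dist y z"] by auto
      also have "\<dots> \<le> (\<bar>L\<bar> + 2 * B) * dist y z powr \<beta>"
        using B \<open>dist y z \<le> dist y z powr \<beta>\<close> by (intro mult_mono) auto
      finally show ?thesis .
    next
      case False
      then have "1 \<le> dist y z powr \<beta>" using assms by (intro ge_one_powr_ge_zero) auto
      then have "(\<bar>L\<bar> + 2 * B) * 1 \<le> (\<bar>L\<bar> + 2 * B) * dist y z powr \<beta>"
        using B by (intro mult_left_mono) auto
      moreover have "\<bar>u y - u z\<bar> \<le> \<bar>L\<bar> + 2 * B"
        using assms(3)[of y] assms(3)[of z] by (simp add: abs_if split: if_splits)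
      ultimately show ?thesis by simp
    qed
  qed
  moreover have "0 \<le> \<bar>L\<bar> + 2 * B" using assms(3)[of undefined] by linarith
  ultimately show ?thesis unfolding Lip_def by blast
qed

lemma ennreal_le_suminf: "f i \<le> (\<Sum>i. f i :: ennreal)"
  using sum_le_suminf[of f "{i}"] by simp

section \<open>Piecewise linear bumps and dyadic decomposition of negative powers\<close>

definition bump :: "real \<Rightarrow> real" where
  "bump t = max 0 (min 1 (2 - t))"

lemma bump_nonneg: "0 \<le> bump t" and bump_le_1: "bump t \<le> 1"
  and bump_eq_1: "t \<le> 1 \<Longrightarrow> bump t = 1" and bump_eq_0: "2 \<le> t \<Longrightarrow> bump t = 0"
  and bump_Lipschitz: "\<bar>bump s - bump t\<bar> \<le> \<bar>s - t\<bar>"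
  by (auto simp: bump_def)

lemma bump_dist_diff:
  assumes "0 < s"
  shows "\<bar>bump (dist y w / s) - bump (dist z w / s)\<bar> \<le> min 1 (dist y z / s)"
proof -
  have "\<bar>bump (dist y w / s) - bump (dist z w / s)\<bar> \<le> \<bar>dist y w / s - dist z w / s\<bar>"
    by (rule bump_Lipschitz)
  also have "\<dots> = \<bar>dist y w - dist z w\<bar> / s" using assms by (simp flip: diff_divide_distrib)
  also have "\<dots> \<le> dist y z / s"
    using assms abs_dist_diff_le[of y w z] by (intro divide_right_mono) (auto simp: dist_commute)
  moreover have "\<bar>bump (dist y w / s) - bump (dist z w / s)\<bar> \<le> 1"
    using bump_nonneg[of "dist y w / s"] bump_le_1[of "dist y w / s"] bump_nonneg[of "dist z w / s"] bump_le_1[of "dist z w / s"] by linarith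
  ultimately show ?thesis by simp
qed

text \<open>Additive form, ready to be multiplied by a function with values in [0, \<infinity>] and
  integrated. Off the ball about y the left side is 0; on it the indicator is 1 and absorbs the
  difference of the bumps.\<close>

lemma bump_dist_diff_ball:
  assumes "0 < s"
  shows "bump (dist y w / s) \<le> bump (dist z w / s)
    + min 1 (dist y z / s) * (indicator (ball y (2 * s)) w + indicator (ball z (2 * s)) w)"
proof (cases "w \<in> ball y (2 * s)")
  case True
  have "min 1 (dist y z / s) * 1 \<le> min 1 (dist y z / s) * (indicator (ball y (2 * s)) w + indicator (ball z (2 * s)) w)"
    using True assms by (intro mult_left_mono) auto
  then show ?thesis using bump_dist_diff[OF assms, of y w z] by linarith
next
  case False
  then have "bump (dist y w / s) = 0" using assms by (intro bump_eq_0) (simp add: field_simps)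
  moreover have "0 \<le> min 1 (dist y z / s) * (indicator (ball y (2 * s)) w + indicator (ball z (2 * s)) w)"
    using assms by (intro mult_nonneg_nonneg) auto
  ultimately show ?thesis using bump_nonneg[of "dist z w / s"] by linarith
qed

text \<open>Takes the place of Hoelder's inequality: either t \<le> a or (t / a)^(p - 1) \<ge> 1.
  The free parameter a will vary with the scale.\<close>

lemma ennreal_le_young:
  assumes "0 < a" "1 < p"
  shows "t \<le> ennreal a + ennreal (a powr (1 - p)) * ennreal_powr t p"
proof (cases t)
  case (real b)
  have "b \<le> a + a powr (1 - p) * b powr p"
  proof (cases "b \<le> a")
    case True then show ?thesis using assms by (simp add: add_increasing2)
  next
    case False
    then have "b = b powr (1 - p) * b powr p" using assms by (simp flip: powr_add)
    also have "\<dots> \<le> a powr (1 - p) * b powr p"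
      using False assms by (intro mult_right_mono powr_mono2') auto
    finally show ?thesis using assms by simp
  qed
  then have "ennreal b \<le> ennreal (a + a powr (1 - p) * b powr p)" by (rule ennreal_leI)
  then show ?thesis using real assms by (simp add: ennreal_powr_ennreal ennreal_mult)
next
  case top
  then show ?thesis using assms by (simp add: ennreal_powr_def ennreal_mult_top)
qed

lemma ennreal_inverse_cancel:
  assumes "0 < c"
  shows "ennreal (inverse c) * (ennreal c * t) = t" "ennreal c * (ennreal (inverse c) * t) = t"
  using assms by (simp_all add: mult.assoc[symmetric] flip: ennreal_mult)

lemma ennreal_affine:
  assumes "0 \<le> a" "0 \<le> b" "0 \<le> c" "0 \<le> d"
  shows "ennreal a * (ennreal b + ennreal c * ennreal d) = ennreal (a * (b + c * d))"
  using assms by (simp add: ennreal_mult)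

text \<open>A distance \<open>d\<close> below \<open>\<rho>\<close> lies between \<open>\<rho> / 2 ^ Suc i\<close> and \<open>\<rho> / 2 ^ i\<close> for some \<open>i\<close>, any other
  distance between \<open>\<rho> * 2 ^ i\<close> and \<open>\<rho> * 2 ^ Suc i\<close>.\<close>

lemma powr_le_dyadic_scales:
  fixes \<rho> d \<gamma> :: real
  assumes "0 < \<rho>" "0 < d" "0 < \<gamma>"
  shows "ennreal (d powr (-\<gamma>)) \<le> ennreal (2 powr \<gamma>) *
    (if d < \<rho> then (\<Sum>i. ennreal ((\<rho> / 2 ^ i) powr (-\<gamma>)) * ennreal (bump (d / (\<rho> / 2 ^ i))))
     else (\<Sum>i. ennreal ((\<rho> * 2 ^ Suc i) powr (-\<gamma>)) * indicator {..<\<rho> * 2 ^ Suc i} d))"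
proof -
  \<comment> \<open>The exponent is negative, so passing from d to a scale s \<le> 2 d costs at most
    the factor 2^\<gamma>.\<close>
  have double: "d powr (-\<gamma>) \<le> 2 powr \<gamma> * s powr (-\<gamma>)" if "s \<le> 2 * d" "0 < s" for s
  proof -
    have "d powr (-\<gamma>) = 2 powr \<gamma> * (2 * d) powr (-\<gamma>)"
      using assms by (simp add: powr_mult mult.assoc[symmetric] flip: powr_add)
    also have "\<dots> \<le> 2 powr \<gamma> * s powr (-\<gamma>)"
      using that assms by (intro mult_left_mono powr_mono2') auto
    finally show ?thesis .
  qed
  show ?thesis
  proof (cases "d < \<rho>")
    case True
    define i where "i = (LEAST j. \<rho> / 2 ^ Suc j \<le> d)"
    obtain j where "\<rho> / d < 2 ^ j" using real_arch_pow[of 2 "\<rho> / d"] by auto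
    then have "\<rho> / 2 ^ Suc j \<le> d" using assms by (simp add: field_simps)
    then have i: "\<rho> / 2 ^ Suc i \<le> d" unfolding i_def by (rule LeastI)
    \<comment> \<open>Minimality of i bounds d from above, and for i = 0 the case assumption does.
      So the bump at this scale is on its plateau.\<close>
    have "d \<le> \<rho> / 2 ^ i"
    proof (cases i)
      case (Suc k)
      then have "k < i" by simp
      then have "\<not> \<rho> / 2 ^ Suc k \<le> d" unfolding i_def by (rule not_less_Least)
      then show ?thesis using Suc by simp
    qed (use True in simp)
    then have bump: "bump (d / (\<rho> / 2 ^ i)) = 1" using assms by (intro bump_eq_1) (simp add: field_simps)
    have "ennreal (d powr (-\<gamma>)) \<le> ennreal (2 powr \<gamma> * (\<rho> / 2 ^ i) powr (-\<gamma>))"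
      using i assms by (intro ennreal_leI double) auto
    also have "\<dots> = ennreal (2 powr \<gamma>) * (ennreal ((\<rho> / 2 ^ i) powr (-\<gamma>)) * ennreal (bump (d / (\<rho> / 2 ^ i))))"
      by (simp only: bump) (simp add: ennreal_mult)
    also have "\<dots> \<le> ennreal (2 powr \<gamma>) * (\<Sum>i. ennreal ((\<rho> / 2 ^ i) powr (-\<gamma>)) * ennreal (bump (d / (\<rho> / 2 ^ i))))"
      by (intro mult_left_mono ennreal_le_suminf[of "\<lambda>i. ennreal ((\<rho> / 2 ^ i) powr (-\<gamma>)) * ennreal (bump (d / (\<rho> / 2 ^ i)))"]) auto
    finally show ?thesis using True by simp
  next
    case False
    define i where "i = (LEAST j. d < \<rho> * 2 ^ Suc j)"
    obtain j where "d / \<rho> < 2 ^ j" using real_arch_pow[of 2 "d / \<rho>"] by auto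
    then have "d < \<rho> * 2 ^ Suc j" using assms by (simp add: field_simps)
    then have i: "d < \<rho> * 2 ^ Suc i" unfolding i_def by (rule LeastI)
    have "\<rho> * 2 ^ Suc i \<le> 2 * d"
    proof (cases i)
      case (Suc k)
      then have "k < i" by simp
      then have "\<not> d < \<rho> * 2 ^ Suc k" unfolding i_def by (rule not_less_Least)
      then show ?thesis using Suc by simp
    qed (use False in simp)
    then have "ennreal (d powr (-\<gamma>)) \<le> ennreal (2 powr \<gamma> * (\<rho> * 2 ^ Suc i) powr (-\<gamma>))"
      using assms by (intro ennreal_leI double) auto
    also have "\<dots> = ennreal (2 powr \<gamma>) * (ennreal ((\<rho> * 2 ^ Suc i) powr (-\<gamma>)) * indicator {..<\<rho> * 2 ^ Suc i} d)"
      using i by (simp add: ennreal_mult)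
    also have "\<dots> \<le> ennreal (2 powr \<gamma>) * (\<Sum>i. ennreal ((\<rho> * 2 ^ Suc i) powr (-\<gamma>)) * indicator {..<\<rho> * 2 ^ Suc i} d)"
      by (intro mult_left_mono ennreal_le_suminf[of "\<lambda>i. ennreal ((\<rho> * 2 ^ Suc i) powr (-\<gamma>)) * indicator {..<\<rho> * 2 ^ Suc i} d"]) auto
    finally show ?thesis using False by simp
  qed
qed

section \<open>Spaces with a regular measure\<close>

text \<open>One constant K serves all estimates. The upper bound is demanded at every radius, so
  that all large scales can be treated alike. A lower bound must stop at the diameter, since a
  bounded space has finite measure; comparing r with some \<open>dist a b\<close> expresses this
  without a diameter that may be infinite.\<close>

locale regular_space = metric_measure_space M for M :: "'a::metric_space measure" +
  fixes Q K :: real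
  assumes Q_pos: "0 < Q" and K_ge_1: "1 \<le> K"
    and measure_ball_double: "0 < r \<Longrightarrow> measure M (ball x (2 * r)) \<le> K * measure M (ball x r)"
    and measure_ball_le: "0 < r \<Longrightarrow> measure M (ball x r) \<le> K * r powr Q"
    and measure_ball_ge: "0 < r \<Longrightarrow> r \<le> dist (a::'a) b \<Longrightarrow> r powr Q \<le> K * measure M (ball x r)"
    and complete_UNIV: "complete (UNIV :: 'a set)"
begin

section \<open>Measures of balls, finite nets and properness\<close>

lemma sets_borel [measurable (raw)]: "A \<in> sets borel \<Longrightarrow> A \<in> sets M"
  using borel_sets by auto

lemma open_sets: "open A \<Longrightarrow> A \<in> sets M" by (rule sets_borel) simp

lemma ball_sets [measurable, simp]: "ball x r \<in> sets M" by (rule open_sets) simp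

lemma measurable_continuous:
  assumes "continuous_on UNIV f" shows "f \<in> borel_measurable M"
proof -
  have "f \<in> borel_measurable borel" using assms by (rule borel_measurable_continuous_onI)
  then show ?thesis unfolding measurable_def using borel_sets space_UNIV by auto
qed

lemma dist_measurable [measurable]: "(\<lambda>w. dist y w) \<in> borel_measurable M"
  by (intro measurable_continuous continuous_intros)

lemma emeasure_ball: "emeasure M (ball x r) = ennreal (measure M (ball x r))"
proof (cases "r > 0")
  case True
  then show ?thesis using ball_finite[of r x] by (intro emeasure_eq_ennreal_measure) auto
qed (simp add: ball_empty)

lemma measure_ball_pos: "0 < r \<Longrightarrow> 0 < measure M (ball x r)"
  using ball_positive[of r x] by (simp add: emeasure_ball)

lemma measure_ball_mono: "ball x r \<subseteq> ball y s \<Longrightarrow> measure M (ball x r) \<le> measure M (ball y s)"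
  using emeasure_mono[of "ball x r" "ball y s" M] by (simp add: emeasure_ball)

lemma measure_ball_double_iter:
  "0 < r \<Longrightarrow> measure M (ball x (2 ^ n * r)) \<le> K ^ n * measure M (ball x r)"
proof (induction n)
  case (Suc n)
  have "measure M (ball x (2 ^ Suc n * r)) \<le> K * measure M (ball x (2 ^ n * r))"
    using measure_ball_double[of "2 ^ n * r" x] Suc.prems by (simp add: mult.assoc)
  also have "\<dots> \<le> K * (K ^ n * measure M (ball x r))"
    using Suc K_ge_1 by (intro mult_left_mono) auto
  finally show ?case by (simp add: mult.assoc)
qed simp

lemma sigma_finite: "sigma_finite_measure M"
proof
  let ?x = "undefined :: 'a"
  let ?A = "range (\<lambda>n. ball ?x (real n + 1))"
  have "y \<in> \<Union>?A" for y
  proof -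
    obtain n :: nat where "dist ?x y < real n" using reals_Archimedean2 by blast
    then show ?thesis by (auto intro!: exI[of _ n])
  qed
  then have "countable ?A \<and> ?A \<subseteq> sets M \<and> \<Union>?A = space M \<and> (\<forall>a\<in>?A. emeasure M a \<noteq> \<infinity>)"
    using space_UNIV by (auto simp: emeasure_ball)
  then show "\<exists>A. countable A \<and> A \<subseteq> sets M \<and> \<Union>A = space M \<and> (\<forall>a\<in>A. emeasure M a \<noteq> \<infinity>)"
    by blast
qed

text \<open>An \<open>e\<close>-separated subset of the ball with the largest possible number of points is an \<open>e\<close>-net;
  the number is bounded because the balls of radius \<open>e / 2\<close> are disjoint and have comparable measure.\<close>

lemma ball_finite_net:
  assumes "0 < e"
  shows "\<exists>S. finite S \<and> ball (x::'a) R \<subseteq> (\<Union>c\<in>S. ball c e)"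
proof (cases "0 < R")
  case True
  define P where "P S \<longleftrightarrow> finite S \<and> S \<subseteq> ball x R \<and> (\<forall>a\<in>S. \<forall>b\<in>S. a \<noteq> b \<longrightarrow> e \<le> dist a b)" for S
  define m where "m = measure M (ball x (R + e))"
  \<comment> \<open>After n doublings the radius e / 2 exceeds 2 (R + e), so the enlarged ball about
    any centre in \<open>ball x R\<close> contains \<open>ball x (R + e)\<close>.\<close>
  obtain n where n: "4 * (R + e) / e < 2 ^ n" using real_arch_pow[of 2 "4 * (R + e) / e"] by auto
  have m: "0 < m" using measure_ball_pos[of "R + e" x] True assms by (simp add: m_def)
  have le: "m \<le> K ^ n * measure M (ball c (e / 2))" if "c \<in> ball x R" for c
  proof -
    have "m \<le> measure M (ball c (2 ^ n * (e / 2)))" unfolding m_def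
    proof (rule measure_ball_mono, rule)
      fix w assume "w \<in> ball x (R + e)"
      then have "dist c w < 2 * (R + e)"
        using that dist_triangle2[of c w x] dist_triangle[of c w x] assms by (auto simp: dist_commute)
      also have "\<dots> < 2 ^ n * (e / 2)" using n assms by (simp add: field_simps)
      finally show "w \<in> ball c (2 ^ n * (e / 2))" by simp
    qed
    also have "\<dots> \<le> K ^ n * measure M (ball c (e / 2))"
      using assms by (intro measure_ball_double_iter) simp
    finally show ?thesis .
  qed
  have card: "real (card S) \<le> K ^ n" if "P S" for S
  proof -
    have S: "finite S" "S \<subseteq> ball x R" and sep: "\<And>a b. a \<in> S \<Longrightarrow> b \<in> S \<Longrightarrow> a \<noteq> b \<Longrightarrow> e \<le> dist a b"
      using that by (auto simp: P_def)
    have disj: "disjoint_family_on (\<lambda>c. ball c (e / 2)) S"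
      unfolding disjoint_family_on_def
    proof (intro ballI impI)
      fix a b assume "a \<in> S" "b \<in> S" "a \<noteq> b"
      then have "e \<le> dist a b" by (rule sep)
      then have "\<not> (dist a w < e / 2 \<and> dist b w < e / 2)" for w
        using dist_triangle2[of a b w] by linarith
      then show "ball a (e / 2) \<inter> ball b (e / 2) = {}" by auto
    qed
    have "real (card S) * m = (\<Sum>c\<in>S. m)" by simp
    also have "\<dots> \<le> (\<Sum>c\<in>S. K ^ n * measure M (ball c (e / 2)))"
      using S le by (intro sum_mono) auto
    also have "\<dots> = K ^ n * (\<Sum>c\<in>S. measure M (ball c (e / 2)))" by (simp add: sum_distrib_left)
    also have "(\<Sum>c\<in>S. measure M (ball c (e / 2))) = measure M (\<Union>c\<in>S. ball c (e / 2))"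
      using S disj by (intro measure_finite_Union[symmetric]) (auto simp: emeasure_ball)
    also have "\<dots> \<le> m" unfolding m_def
    proof (rule measure_mono_fmeasurable)
      show "(\<Union>c\<in>S. ball c (e / 2)) \<subseteq> ball x (R + e)"
      proof clarsimp
        fix c w assume "c \<in> S" "dist c w * 2 < e"
        then show "dist x w < R + e" using S(2) dist_triangle[of x w c] assms by force
      qed
      show "ball x (R + e) \<in> fmeasurable M" by (rule fmeasurableI) (auto simp: emeasure_ball)
    qed (use S in auto)
    finally show ?thesis using m K_ge_1 by (simp add: mult_le_cancel_right)
  qed
  have "P {}" by (simp add: P_def)
  moreover obtain b where "K ^ n < real b" using reals_Archimedean2 by blast
  then have "\<forall>S. P S \<longrightarrow> card S < b"
    using card by (meson le_less_trans of_nat_less_iff)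
  ultimately obtain S where S: "P S" "\<And>T. P T \<Longrightarrow> card T \<le> card S"
    using ex_has_greatest_nat[of P "{}" card b] by auto
  have "ball x R \<subseteq> (\<Union>c\<in>S. ball c e)"
  proof
    fix w assume w: "w \<in> ball x R"
    show "w \<in> (\<Union>c\<in>S. ball c e)"
    proof (rule ccontr)
      assume "w \<notin> (\<Union>c\<in>S. ball c e)"
      then have far: "\<And>c. c \<in> S \<Longrightarrow> e \<le> dist c w" by (auto simp: not_less)
      then have "w \<notin> S" using assms by fastforce
      have "P (insert w S)" using S(1) w far by (auto simp: P_def dist_commute)
      then have "card (insert w S) \<le> card S" by (rule S(2))
      moreover have "finite S" using S(1) by (simp add: P_def)
      ultimately show False using \<open>w \<notin> S\<close> by simp
    qed
  qed
  then show ?thesis using S(1) by (auto simp: P_def)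
next
  case False
  then show ?thesis by (intro exI[of _ "{}"]) (simp add: ball_empty)
qed

text \<open>Properness: completeness passes to closed subsets, and the finite nets give total
  boundedness.\<close>

lemma compact_closed_ball_subset:
  assumes "closed F" "F \<subseteq> ball (x::'a) R" shows "compact F"
  unfolding compact_eq_totally_bounded
proof (intro conjI allI impI)
  show "complete F"
    unfolding complete_def
  proof (intro allI impI)
    fix s assume s: "(\<forall>n. s n \<in> F) \<and> Cauchy s"
    then obtain l where "s \<longlonglongrightarrow> l" using complete_UNIV unfolding complete_def by (meson UNIV_I)
    then show "\<exists>l\<in>F. s \<longlonglongrightarrow> l" using s assms(1) closed_sequentially by blast
  qed
  fix e :: real assume "0 < e"
  then show "\<exists>k. finite k \<and> F \<subseteq> (\<Union>c\<in>k. ball c e)"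
    using ball_finite_net[of e x R] assms(2) by blast
qed

text \<open>Collects the finite nets of mesh 1 / (m + 1) in balls of radius n. The form of a
  sequence lets pairs of a centre and a scale be numbered later.\<close>

lemma countable_dense: "\<exists>D :: nat \<Rightarrow> 'a. \<forall>y. \<forall>e>0. \<exists>i. dist (D i) y < e"
proof -
  let ?x = "undefined :: 'a"
  have "\<forall>n m. \<exists>S. finite S \<and> ball ?x (real n) \<subseteq> (\<Union>c\<in>S. ball c (1 / real (Suc m)))"
    by (intro allI ball_finite_net) simp
  then obtain S where S: "\<And>n m. finite (S n m)"
    "\<And>n m. ball ?x (real n) \<subseteq> (\<Union>c\<in>S n m. ball c (1 / real (Suc m)))"
    by metis
  define D where "D = (\<Union>n m. S n m)"
  have cD: "countable D" unfolding D_def using S(1) by (intro countable_UN countableI_type countable_finite) auto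
  have dense: "\<exists>c\<in>D. dist c y < e" if "e > 0" for y e
  proof -
    obtain n :: nat where n: "dist ?x y < real n" using reals_Archimedean2 by blast
    obtain m :: nat where m: "1 / real (Suc m) < e"
      using \<open>e > 0\<close> nat_approx_posE by blast
    obtain c where "c \<in> S n m" "dist c y < 1 / real (Suc m)" using n S(2)[of n m] by fastforce
    then have "c \<in> D" "dist c y < e" using m by (auto simp: D_def)
    then show ?thesis by blast
  qed
  have "D \<noteq> {}" using dense[of 1] by auto
  then have "range (from_nat_into D) = D" using cD by (rule range_from_nat_into)
  then show ?thesis using dense by (metis rangeE)
qed

section \<open>The maximal theorem\<close>

text \<open>The supremum is over a countable family of balls, so that measurability is immediate and the
  covering argument only involves finitely many balls at a time.\<close>

definition maximal :: "(nat \<Rightarrow> 'a) \<Rightarrow> (nat \<Rightarrow> real) \<Rightarrow> ('a \<Rightarrow> ennreal) \<Rightarrow> 'a \<Rightarrow> ennreal" where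
  "maximal c q f y = (SUP k. indicator (ball (c k) (q k)) y *
    ((\<integral>\<^sup>+w. f w * indicator (ball (c k) (q k)) w \<partial>M) / emeasure M (ball (c k) (q k))))"

lemma measurable_maximal [measurable]: "maximal c q f \<in> borel_measurable M"
  unfolding maximal_def by measurable

lemma ball_integral_le_maximal:
  assumes "0 < q k" "y \<in> ball (c k) (q k)"
  shows "(\<integral>\<^sup>+w. f w * indicator (ball (c k) (q k)) w \<partial>M) \<le> emeasure M (ball (c k) (q k)) * maximal c q f y"
proof -
  let ?B = "ball (c k) (q k)"
  have "(\<integral>\<^sup>+w. f w * indicator ?B w \<partial>M) = emeasure M ?B * ((\<integral>\<^sup>+w. f w * indicator ?B w \<partial>M) / emeasure M ?B)"
    using ball_positive[OF assms(1), of "c k"] ball_finite[OF assms(1), of "c k"]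
    by (subst ennreal_times_divide, subst mult.commute, subst mult_divide_eq_ennreal) auto
  also have "\<dots> \<le> emeasure M ?B * maximal c q f y"
    unfolding maximal_def using assms(2)
    by (intro mult_left_mono) (auto intro!: SUP_upper2[of k])
  finally show ?thesis .
qed

text \<open>Where 2 f \<le> \<tau>, f contributes at most \<tau> / 2 to any average, so the large
  values alone carry half of the required mass of each ball. Tripled balls of a disjoint subfamily
  cover the union; two doublings account for K^2.\<close>

lemma weak_type_finite:
  assumes [measurable]: "f \<in> borel_measurable M" and "0 < \<tau>" "finite I" "\<And>k. k \<in> I \<Longrightarrow> 0 < q k"
    and large: "\<And>k. k \<in> I \<Longrightarrow>
      ennreal \<tau> * emeasure M (ball (c k) (q k)) \<le> (\<integral>\<^sup>+w. f w * indicator (ball (c k) (q k)) w \<partial>M)"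
  shows "ennreal \<tau> * emeasure M (\<Union>k\<in>I. ball (c k) (q k))
    \<le> ennreal (2 * K\<^sup>2) * (\<integral>\<^sup>+w. f w * indicator {w. ennreal \<tau> < 2 * f w} w \<partial>M)"
proof -
  let ?B = "\<lambda>k. ball (c k) (q k)"
  define h where "h w = f w * indicator {w. ennreal \<tau> < 2 * f w} w" for w
  have [measurable]: "h \<in> borel_measurable M" unfolding h_def by measurable
  obtain J where J: "J \<subseteq> I" "disjoint_family_on ?B J" "(\<Union>k\<in>I. ?B k) \<subseteq> (\<Union>k\<in>J. ball (c k) (3 * q k))"
    using finite_disjoint_balls[of I q c] assms by blast
  have "finite J" using J(1) assms(3) by (rule finite_subset)
  have half: "ennreal (\<tau> / 2) * emeasure M (?B k) \<le> (\<integral>\<^sup>+w. h w * indicator (?B k) w \<partial>M)" if "k \<in> J" for k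
  proof -
    have "k \<in> I" using that J by auto
    have le: "f w \<le> h w + ennreal (\<tau> / 2)" for w
    proof (cases "ennreal \<tau> < 2 * f w")
      case False
      then have "f w \<le> ennreal (\<tau> / 2)"
        using \<open>0 < \<tau>\<close> by (cases "f w") (auto simp: not_less two_mult_ennreal ennreal_mult_top)
      then show ?thesis by (simp add: add_increasing)
    qed (simp add: h_def)
    have "ennreal (\<tau> / 2) * emeasure M (?B k) + ennreal (\<tau> / 2) * emeasure M (?B k) = ennreal \<tau> * emeasure M (?B k)"
      using assms(2) by (simp flip: distrib_right ennreal_plus)
    also have "\<dots> \<le> (\<integral>\<^sup>+w. f w * indicator (?B k) w \<partial>M)" by (rule large[OF \<open>k \<in> I\<close>])
    also have "\<dots> \<le> (\<integral>\<^sup>+w. (h w * indicator (?B k) w + ennreal (\<tau> / 2) * indicator (?B k) w) \<partial>M)"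
      using le by (intro nn_integral_mono) (auto simp: indicator_def)
    also have "\<dots> = (\<integral>\<^sup>+w. h w * indicator (?B k) w \<partial>M) + ennreal (\<tau> / 2) * emeasure M (?B k)"
      by (subst nn_integral_add) (auto simp: nn_integral_cmult_indicator)
    \<comment> \<open>Cancelling is legitimate because
      \<open>ennreal (\<tau> / 2) * emeasure M (?B k)\<close> is finite.\<close>
    finally show ?thesis
      by (subst (asm) add.commute[of "\<integral>\<^sup>+w. h w * indicator (?B k) w \<partial>M"])
        (auto simp: ennreal_add_left_cancel_le emeasure_ball ennreal_mult_eq_top_iff)
  qed
  have "emeasure M (\<Union>k\<in>I. ?B k) \<le> emeasure M (\<Union>k\<in>J. ball (c k) (3 * q k))"
    using J(3) \<open>finite J\<close> by (intro emeasure_mono) auto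
  also have "\<dots> \<le> (\<Sum>k\<in>J. emeasure M (ball (c k) (3 * q k)))"
    using \<open>finite J\<close> by (intro emeasure_subadditive_finite) auto
  also have "\<dots> \<le> (\<Sum>k\<in>J. ennreal (K\<^sup>2) * emeasure M (?B k))"
  proof (intro sum_mono)
    fix k assume "k \<in> J"
    then have "0 < q k" using J(1) assms(4) by auto
    have "measure M (ball (c k) (3 * q k)) \<le> measure M (ball (c k) (2 ^ 2 * q k))"
      using \<open>0 < q k\<close> by (intro measure_ball_mono) auto
    also have "\<dots> \<le> K\<^sup>2 * measure M (?B k)"
      using \<open>0 < q k\<close> by (rule measure_ball_double_iter)
    finally show "emeasure M (ball (c k) (3 * q k)) \<le> ennreal (K\<^sup>2) * emeasure M (?B k)"
      by (simp add: emeasure_ball flip: ennreal_mult)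
  qed
  also have "\<dots> = ennreal (K\<^sup>2) * (\<Sum>k\<in>J. emeasure M (?B k))" by (simp add: sum_distrib_left)
  finally have "ennreal \<tau> * emeasure M (\<Union>k\<in>I. ?B k)
      \<le> ennreal \<tau> * (ennreal (K\<^sup>2) * (\<Sum>k\<in>J. emeasure M (?B k)))"
    by (intro mult_left_mono) auto
  also have "\<dots> = ennreal (2 * K\<^sup>2) * (\<Sum>k\<in>J. ennreal (\<tau> / 2) * emeasure M (?B k))"
    using assms(2) by (simp flip: ennreal_mult mult.assoc sum_distrib_left) (simp add: mult.commute)
  also have "\<dots> \<le> ennreal (2 * K\<^sup>2) * (\<Sum>k\<in>J. (\<integral>\<^sup>+w. h w * indicator (?B k) w \<partial>M))"
    by (intro mult_left_mono sum_mono half) auto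
  also have "(\<Sum>k\<in>J. (\<integral>\<^sup>+w. h w * indicator (?B k) w \<partial>M)) = (\<integral>\<^sup>+w. h w * (\<Sum>k\<in>J. indicator (?B k) w) \<partial>M)"
    by (subst nn_integral_sum[symmetric]) (auto simp: sum_distrib_left)
  also have "\<dots> \<le> (\<integral>\<^sup>+w. h w \<partial>M)"
  proof (intro nn_integral_mono)
    fix w
    have "(\<Sum>k\<in>J. indicator (?B k) w) = (indicator (\<Union>k\<in>J. ?B k) w :: ennreal)"
      using \<open>finite J\<close> J(2) by (simp add: indicator_UN_disjoint)
    also have "\<dots> \<le> 1" by (simp add: indicator_def)
    finally have "h w * (\<Sum>k\<in>J. indicator (?B k) w) \<le> h w * 1" by (intro mult_left_mono) auto
    then show "h w * (\<Sum>k\<in>J. indicator (?B k) w) \<le> h w" by simp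
  qed
  finally show ?thesis by (auto simp: h_def mult_left_mono)
qed

text \<open>Exceeding \<tau> is witnessed by a single ball, so the superlevel set is a union of
  balls of large average. Finite subfamilies exhaust it, with a bound that does not depend on their
  number.\<close>

lemma weak_type:
  assumes [measurable]: "f \<in> borel_measurable M" and "0 < \<tau>" and q: "\<And>k. 0 < q k"
  shows "ennreal \<tau> * emeasure M {y. ennreal \<tau> < maximal c q f y}
    \<le> ennreal (2 * K\<^sup>2) * (\<integral>\<^sup>+w. f w * indicator {w. ennreal \<tau> < 2 * f w} w \<partial>M)" (is "_ \<le> ?R")
proof -
  let ?B = "\<lambda>k. ball (c k) (q k)"
  let ?avg = "\<lambda>k. (\<integral>\<^sup>+w. f w * indicator (?B k) w \<partial>M) / emeasure M (?B k)"
  define A where "A n = (\<Union>k\<in>{k. k < n \<and> ennreal \<tau> < ?avg k}. ?B k)" for n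
  have "{y. ennreal \<tau> < maximal c q f y} = (\<Union>n. A n)"
  proof (intro set_eqI iffI)
    fix y assume "y \<in> {y. ennreal \<tau> < maximal c q f y}"
    then obtain k where k: "ennreal \<tau> < indicator (?B k) y * ?avg k"
      by (auto simp: maximal_def less_SUP_iff)
    then have "y \<in> ?B k" "ennreal \<tau> < ?avg k" by (auto split: split_indicator_asm)
    then have "y \<in> A (Suc k)" by (auto simp: A_def)
    then show "y \<in> (\<Union>n. A n)" by blast
  next
    fix y assume "y \<in> (\<Union>n. A n)"
    then obtain k where "y \<in> ?B k" "ennreal \<tau> < ?avg k" by (auto simp: A_def)
    then have "ennreal \<tau> < indicator (?B k) y * ?avg k" by simp
    then show "y \<in> {y. ennreal \<tau> < maximal c q f y}"
      unfolding maximal_def mem_Collect_eq less_SUP_iff by blast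
  qed
  moreover have "(SUP n. emeasure M (A n)) = emeasure M (\<Union>n. A n)"
  proof (rule SUP_emeasure_incseq)
    show "range A \<subseteq> sets M" by (auto simp: A_def)
    show "incseq A" unfolding A_def incseq_def by (intro allI impI UN_mono) auto
  qed
  moreover have "ennreal \<tau> * (SUP n. emeasure M (A n)) \<le> ?R"
    unfolding SUP_mult_left_ennreal
  proof (rule SUP_least)
    fix n show "ennreal \<tau> * emeasure M (A n) \<le> ?R"
      unfolding A_def
    proof (rule weak_type_finite)
      fix k assume "k \<in> {k. k < n \<and> ennreal \<tau> < ?avg k}"
      then have "ennreal \<tau> * emeasure M (?B k) \<le> ?avg k * emeasure M (?B k)"
        by (intro mult_right_mono) auto
      also have "\<dots> = (\<integral>\<^sup>+w. f w * indicator (?B k) w \<partial>M)"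
        using ball_positive[OF q[of k], of "c k"] ball_finite[OF q[of k], of "c k"]
        by (simp add: ennreal_divide_times)
      finally show "ennreal \<tau> * emeasure M (?B k) \<le> (\<integral>\<^sup>+w. f w * indicator (?B k) w \<partial>M)" .
    qed (use assms in auto)
  qed
  ultimately show ?thesis by simp
qed

text \<open>Marcinkiewicz interpolation: write the p-th power as an integral over levels, apply the
  weak-type bound at each level and integrate back by Fubini. The truncation to 2 f > \<tau> makes
  the final level integral a multiple of a power of f.\<close>

theorem maximal_Lp:
  assumes [measurable]: "f \<in> borel_measurable M" and p: "1 < p" and q: "\<And>k. 0 < q k"
  shows "(\<integral>\<^sup>+y. ennreal_powr (maximal c q f y) p \<partial>M)
    \<le> ennreal (2 * K\<^sup>2 * (p / (p - 1) * 2 powr (p - 1))) * (\<integral>\<^sup>+y. ennreal_powr (f y) p \<partial>M)"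
proof -
  interpret sigma_finite_measure M by (rule sigma_finite)
  interpret P: pair_sigma_finite lborel M by standard
  let ?m = "maximal c q f"
  have "(\<integral>\<^sup>+y. ennreal_powr (?m y) p \<partial>M) \<le>
    (\<integral>\<^sup>+y. (\<integral>\<^sup>+\<tau>. ennreal (p * \<tau> powr (p - 1)) * indicator {\<tau>. 0 < \<tau> \<and> ennreal \<tau> < ?m y} \<tau> \<partial>lborel) \<partial>M)"
    using p by (intro nn_integral_mono ennreal_powr_le_layer) auto
  also have "\<dots> = (\<integral>\<^sup>+\<tau>. (\<integral>\<^sup>+y. ennreal (p * \<tau> powr (p - 1)) * indicator {\<tau>. 0 < \<tau> \<and> ennreal \<tau> < ?m y} \<tau> \<partial>M) \<partial>lborel)"
    by (rule P.Fubini') measurable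
  also have "\<dots> \<le> (\<integral>\<^sup>+\<tau>. (\<integral>\<^sup>+y. ennreal (2 * K\<^sup>2) * (f y * (ennreal (p * \<tau> powr (p - 2)) * indicator {\<tau>. 0 < \<tau> \<and> ennreal \<tau> < 2 * f y} \<tau>)) \<partial>M) \<partial>lborel)"
  proof (rule nn_integral_mono)
    fix \<tau> :: real
    show "(\<integral>\<^sup>+y. ennreal (p * \<tau> powr (p - 1)) * indicator {\<tau>. 0 < \<tau> \<and> ennreal \<tau> < ?m y} \<tau> \<partial>M)
      \<le> (\<integral>\<^sup>+y. ennreal (2 * K\<^sup>2) * (f y * (ennreal (p * \<tau> powr (p - 2)) * indicator {\<tau>. 0 < \<tau> \<and> ennreal \<tau> < 2 * f y} \<tau>)) \<partial>M)"
    proof (cases "0 < \<tau>")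
      case True
      have "(\<integral>\<^sup>+y. ennreal (p * \<tau> powr (p - 1)) * indicator {\<tau>. 0 < \<tau> \<and> ennreal \<tau> < ?m y} \<tau> \<partial>M)
        = (\<integral>\<^sup>+y. ennreal (p * \<tau> powr (p - 1)) * indicator {y. ennreal \<tau> < ?m y} y \<partial>M)"
        using True by (intro nn_integral_cong) (simp add: indicator_def)
      also have "\<dots> = ennreal (p * \<tau> powr (p - 1)) * emeasure M {y. ennreal \<tau> < ?m y}"
      proof (rule nn_integral_cmult_indicator)
        have "{y \<in> space M. ennreal \<tau> < ?m y} \<in> sets M" by measurable
        then show "{y. ennreal \<tau> < ?m y} \<in> sets M" using space_UNIV by simp
      qed
      \<comment> \<open>One factor \<tau> is split off to feed the weak-type bound; \<tau>^(p - 2)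
        remains.\<close>
      also have power: "p * \<tau> powr (p - 1) = (p * \<tau> powr (p - 2)) * \<tau>"
        using True powr_add[of \<tau> "p - 2" 1] by simp
      also have "ennreal \<dots> * emeasure M {y. ennreal \<tau> < ?m y}
          = ennreal (p * \<tau> powr (p - 2)) * (ennreal \<tau> * emeasure M {y. ennreal \<tau> < ?m y})"
        using p True by (subst ennreal_mult) (auto simp: mult.assoc)
      also have "\<dots> \<le> ennreal (p * \<tau> powr (p - 2)) *
          (ennreal (2 * K\<^sup>2) * (\<integral>\<^sup>+w. f w * indicator {w. ennreal \<tau> < 2 * f w} w \<partial>M))"
        using True by (intro mult_left_mono weak_type q) auto
      also have "\<dots> = (\<integral>\<^sup>+y. ennreal (p * \<tau> powr (p - 2)) * (ennreal (2 * K\<^sup>2) * (f y * indicator {w. ennreal \<tau> < 2 * f w} y)) \<partial>M)"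
        by (simp add: nn_integral_cmult)
      also have "\<dots> = (\<integral>\<^sup>+y. ennreal (2 * K\<^sup>2) * (f y * (ennreal (p * \<tau> powr (p - 2)) * indicator {\<tau>. 0 < \<tau> \<and> ennreal \<tau> < 2 * f y} \<tau>)) \<partial>M)"
        using True by (intro nn_integral_cong) (simp add: indicator_def mult_ac)
      finally show ?thesis unfolding power .
    qed simp
  qed
  also have "\<dots> = (\<integral>\<^sup>+y. (\<integral>\<^sup>+\<tau>. ennreal (2 * K\<^sup>2) * (f y * (ennreal (p * \<tau> powr (p - 2)) * indicator {\<tau>. 0 < \<tau> \<and> ennreal \<tau> < 2 * f y} \<tau>)) \<partial>lborel) \<partial>M)"
    by (rule P.Fubini'[symmetric]) measurable
  also have "\<dots> = (\<integral>\<^sup>+y. ennreal (2 * K\<^sup>2) * (f y * (\<integral>\<^sup>+\<tau>. ennreal (p * \<tau> powr (p - 2)) * indicator {\<tau>. 0 < \<tau> \<and> ennreal \<tau> < 2 * f y} \<tau> \<partial>lborel)) \<partial>M)"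
    by (simp add: nn_integral_cmult)
  also have "\<dots> \<le> (\<integral>\<^sup>+y. ennreal (2 * K\<^sup>2) * (ennreal (p / (p - 1) * 2 powr (p - 1)) * ennreal_powr (f y) p) \<partial>M)"
    using p by (intro nn_integral_mono mult_left_mono layer_le_ennreal_powr) auto
  also have "\<dots> = ennreal (2 * K\<^sup>2) * ennreal (p / (p - 1) * 2 powr (p - 1)) * (\<integral>\<^sup>+y. ennreal_powr (f y) p \<partial>M)"
    by (simp add: nn_integral_cmult mult.assoc)
  also have "ennreal (2 * K\<^sup>2) * ennreal (p / (p - 1) * 2 powr (p - 1)) = ennreal (2 * K\<^sup>2 * (p / (p - 1) * 2 powr (p - 1)))"
    using p by (intro ennreal_mult[symmetric]) auto
  finally show ?thesis .
qed

section \<open>Riesz capacity is dominated by Hajlasz capacity\<close>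

text \<open>At w = y the integrand of \<open>riesz_potential\<close> is 0 by convention while sums
  of indicators of balls about y are not; this makes that point negligible.\<close>

lemma null_singleton: "{y} \<in> null_sets M"
proof -
  have "emeasure M {y} \<le> ennreal e" if "0 < e" for e
  proof -
    define t where "t = (e / K) powr (1 / Q)"
    have "0 < t" using that K_ge_1 by (simp add: t_def)
    have "emeasure M {y} \<le> emeasure M (ball y t)" using \<open>0 < t\<close> by (intro emeasure_mono) auto
    also have "\<dots> \<le> ennreal (K * t powr Q)"
      using measure_ball_le[OF \<open>0 < t\<close>, of y] by (simp add: emeasure_ball ennreal_leI)
    also have "K * t powr Q = e" using that K_ge_1 Q_pos by (simp add: t_def powr_powr)
    finally show ?thesis .
  qed
  then have "emeasure M {y} = 0"
    using ennreal_le_epsilon[of 0 "emeasure M {y}"] by simp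
  then show ?thesis by (auto intro!: null_setsI sets_borel)
qed

text \<open>Selects sample points off the exceptional set of a gradient inequality. If g exceeded
  its mean almost everywhere on the ball, the excess would be positive there and yet have integral
  0.\<close>

lemma exists_le_average:
  assumes [measurable]: "g \<in> borel_measurable M" and N: "N \<in> null_sets M" and s: "0 < s"
  shows "\<exists>w\<in>ball c s - N. g w * emeasure M (ball c s) \<le> (\<integral>\<^sup>+w. g w * indicator (ball c s) w \<partial>M)"
proof (rule ccontr)
  let ?B = "ball c s"
  let ?I = "\<integral>\<^sup>+w. g w * indicator ?B w \<partial>M"
  define a where "a = ?I / emeasure M ?B"
  have \<mu>: "0 < emeasure M ?B" "emeasure M ?B < \<infinity>" using ball_positive[OF s] ball_finite[OF s] by auto
  assume "\<not> ?thesis"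
  then have less: "?I < g w * emeasure M ?B" if "w \<in> ?B - N" for w using that by (auto simp: not_le)
  have "?B - N \<noteq> {}" using \<mu> N by (metis Diff_eq_empty_iff emeasure_mono null_setsD1 null_setsD2 leD)
  \<comment> \<open>A strict inequality at a single point makes the integral finite, which the
    subtraction below requires.\<close>
  then have fin: "?I < \<infinity>" using less by (metis ex_in_conv infinity_ennreal_def less_top order.strict_trans1 top_greatest not_less_iff_gr_or_eq)
  have aI: "a * emeasure M ?B = ?I" using \<mu> by (simp add: a_def ennreal_divide_times)
  have a: "a < g w" if "w \<in> ?B - N" for w
  proof (rule ccontr)
    assume "\<not> a < g w"
    then have "g w * emeasure M ?B \<le> a * emeasure M ?B" by (intro mult_right_mono) auto
    then show False using less[OF that] aI by simp
  qed
  have AE: "AE w in M. a * indicator ?B w \<le> g w * indicator ?B w"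
    using AE_not_in[OF N] by eventually_elim (use a in \<open>auto simp: indicator_def less_imp_le\<close>)
  have "(\<integral>\<^sup>+w. g w * indicator ?B w - a * indicator ?B w \<partial>M) = ?I - (\<integral>\<^sup>+w. a * indicator ?B w \<partial>M)"
    using fin AE aI by (intro nn_integral_diff) (auto simp: nn_integral_cmult_indicator)
  also have "\<dots> = 0" using fin aI by (simp add: nn_integral_cmult_indicator)
  finally have "AE w in M. g w * indicator ?B w - a * indicator ?B w = 0"
    by (subst (asm) nn_integral_0_iff_AE) auto
  then have "AE w in M. w \<notin> ?B"
    using AE_not_in[OF N]
  proof eventually_elim
    case (elim w)
    show ?case
    proof
      assume "w \<in> ?B"
      then have "a < g w" "g w - a = 0" using a elim by auto
      then show False using diff_gt_0_iff_gt_ennreal[of "g w" a] by simp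
    qed
  qed
  then have "?B \<in> null_sets M" using Measure_Space.AE_iff_null_sets[of ?B M] by simp
  then show False using \<mu> by auto
qed

lemma measurable_measure_ball [measurable]:
  "(\<lambda>w. measure M (ball y (dist y w))) \<in> borel_measurable M"
proof -
  have "mono (\<lambda>t. measure M (ball y t))"
    by (intro monoI measure_ball_mono subset_ball)
  then have "(\<lambda>t. measure M (ball y t)) \<in> borel_measurable borel"
    by (rule borel_measurable_mono)
  then show ?thesis by (rule measurable_compose[OF dist_measurable])
qed

lemma riesz_kernel_ge:
  assumes "y \<noteq> w"
  shows "ennreal (dist y w powr (\<beta> - Q)) \<le> ennreal K * (ennreal (dist y w powr \<beta>) / emeasure M (ball y (dist y w)))"
proof -
  let ?d = "dist y w"
  have d: "0 < ?d" using assms by simp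
  have m: "0 < measure M (ball y ?d)" by (rule measure_ball_pos[OF d])
  have "?d powr (\<beta> - Q) * measure M (ball y ?d) \<le> ?d powr (\<beta> - Q) * (K * ?d powr Q)"
    using measure_ball_le[OF d, of y] by (intro mult_left_mono) auto
  also have "\<dots> = K * ?d powr \<beta>" using d by (simp add: powr_diff)
  finally have "?d powr (\<beta> - Q) \<le> K * (?d powr \<beta> / measure M (ball y ?d))" using m by (simp add: field_simps)
  then show ?thesis using m K_ge_1
    by (simp add: emeasure_ball divide_ennreal ennreal_leI flip: ennreal_mult)
qed

text \<open>A point w at distance d lies in exactly those balls whose radius exceeds d. As \<beta> <
  Q, the smallest such radius dominates, and the weights add up to at most a multiple of d^(\<beta>
  - Q), hence of the Riesz kernel.\<close>

lemma sum_averages_le_riesz: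
  assumes [measurable]: "g \<in> borel_measurable M" and "0 < \<beta>" "\<beta> < Q"
  shows "(\<Sum>i\<le>n. ennreal ((\<rho> / 2 ^ i) powr (\<beta> - Q)) * (\<integral>\<^sup>+w. g w * indicator (ball y (\<rho> / 2 ^ i)) w \<partial>M))
    \<le> ennreal (K / (1 - 2 powr (\<beta> - Q))) * riesz_potential M \<beta> g y"
proof -
  let ?c = "1 - 2 powr (\<beta> - Q)"
  have c: "0 < ?c" using assms by (simp add: powr_less_one)
  have "(\<Sum>i\<le>n. ennreal ((\<rho> / 2 ^ i) powr (\<beta> - Q)) * (\<integral>\<^sup>+w. g w * indicator (ball y (\<rho> / 2 ^ i)) w \<partial>M))
    = (\<Sum>i\<le>n. (\<integral>\<^sup>+w. ennreal ((\<rho> / 2 ^ i) powr (\<beta> - Q)) * (g w * indicator (ball y (\<rho> / 2 ^ i)) w) \<partial>M))"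
    by (simp add: nn_integral_cmult)
  also have "\<dots> = (\<integral>\<^sup>+w. (\<Sum>i\<le>n. ennreal ((\<rho> / 2 ^ i) powr (\<beta> - Q)) * (g w * indicator (ball y (\<rho> / 2 ^ i)) w)) \<partial>M)"
    by (simp add: nn_integral_sum)
  also have "\<dots> = (\<integral>\<^sup>+w. g w * (\<Sum>i\<le>n. ennreal ((\<rho> / 2 ^ i) powr (\<beta> - Q)) * indicator (ball y (\<rho> / 2 ^ i)) w) \<partial>M)"
    unfolding sum_distrib_left by (simp only: mult.left_commute)
  also have "\<dots> \<le> (\<integral>\<^sup>+w. ennreal (K / ?c) * (g w * ennreal (dist y w powr \<beta>) / emeasure M (ball y (dist y w))) \<partial>M)"
  proof (rule nn_integral_mono_AE)
    show "AE w in M. g w * (\<Sum>i\<le>n. ennreal ((\<rho> / 2 ^ i) powr (\<beta> - Q)) * indicator (ball y (\<rho> / 2 ^ i)) w)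
      \<le> ennreal (K / ?c) * (g w * ennreal (dist y w powr \<beta>) / emeasure M (ball y (dist y w)))"
      using AE_not_in[OF null_singleton[of y]]
    proof eventually_elim
      case (elim w)
      then have yw: "y \<noteq> w" by auto
      let ?d = "dist y w"
      have "(\<Sum>i\<le>n. ennreal ((\<rho> / 2 ^ i) powr (\<beta> - Q)) * indicator (ball y (\<rho> / 2 ^ i)) w)
        = (\<Sum>i\<in>{i. i \<le> n \<and> ?d < \<rho> / 2 ^ i}. ennreal ((\<rho> / 2 ^ i) powr (\<beta> - Q)))"
        by (intro sum.mono_neutral_cong_right) auto
      also have "\<dots> = ennreal (\<Sum>i\<in>{i. i \<le> n \<and> ?d < \<rho> / 2 ^ i}. (\<rho> / 2 ^ i) powr (\<beta> - Q))"
        by (rule sum_ennreal) simp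
      also have "\<dots> \<le> ennreal (?d powr (\<beta> - Q) / ?c)"
        using sum_dyadic_ge[of ?d "Q - \<beta>" "{i. i \<le> n \<and> ?d < \<rho> / 2 ^ i}" \<rho>] assms yw
        by (intro ennreal_leI) auto
      also have "\<dots> = ennreal (1 / ?c) * ennreal (?d powr (\<beta> - Q))"
        using c by (simp flip: ennreal_mult)
      also have "\<dots> \<le> ennreal (1 / ?c) * (ennreal K * (ennreal (?d powr \<beta>) / emeasure M (ball y ?d)))"
        by (intro mult_left_mono riesz_kernel_ge yw) auto
      also have "\<dots> = ennreal (K / ?c) * (ennreal (?d powr \<beta>) / emeasure M (ball y ?d))"
        using c K_ge_1 by (simp add: mult.assoc[symmetric] flip: ennreal_mult)
      finally have "g w * (\<Sum>i\<le>n. ennreal ((\<rho> / 2 ^ i) powr (\<beta> - Q)) * indicator (ball y (\<rho> / 2 ^ i)) w)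
        \<le> g w * (ennreal (K / ?c) * (ennreal (?d powr \<beta>) / emeasure M (ball y ?d)))"
        by (intro mult_left_mono) auto
      then show ?case by (simp add: ennreal_times_divide mult.left_commute)
    qed
  qed
  also have "\<dots> = ennreal (K / ?c) * riesz_potential M \<beta> g y"
    unfolding riesz_potential_def
    by (rule nn_integral_cmult) (auto simp: emeasure_ball)
  finally show ?thesis .
qed

lemma exists_small_gradient:
  assumes [measurable]: "g \<in> borel_measurable M" and N: "N \<in> null_sets M" and s: "0 < s" "s \<le> dist (a::'a) b"
  shows "\<exists>w\<in>ball c s - N. g w \<le> ennreal (K * s powr (-Q)) * (\<integral>\<^sup>+w. g w * indicator (ball c s) w \<partial>M)"
proof -
  obtain w where w: "w \<in> ball c s - N"
    "g w * emeasure M (ball c s) \<le> (\<integral>\<^sup>+w. g w * indicator (ball c s) w \<partial>M)" (is "_ \<le> ?I")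
    using exists_le_average[OF assms(1) N s(1), of c] by blast
  have "g w = g w * ennreal (s powr (-Q) * s powr Q)"
    using s by (simp flip: powr_add)
  also have "\<dots> \<le> g w * ennreal (s powr (-Q) * (K * measure M (ball c s)))"
    using s measure_ball_ge[OF s, of c] by (intro mult_left_mono ennreal_leI) auto
  also have "\<dots> = g w * (ennreal (K * s powr (-Q)) * emeasure M (ball c s))"
    using K_ge_1 by (simp add: emeasure_ball mult_ac flip: ennreal_mult)
  also have "\<dots> = ennreal (K * s powr (-Q)) * (g w * emeasure M (ball c s))"
    by (simp only: mult.left_commute)
  also have "\<dots> \<le> ennreal (K * s powr (-Q)) * ?I" using w by (intro mult_left_mono) auto
  finally show ?thesis using w(1) by blast
qed

text \<open>Telescoping along points \<open>w i\<close> of the balls \<open>ball y (5 * r / 2 ^ i)\<close> at which \<open>g\<close> does not exceed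
  its average over the ball, starting from a point where \<open>u\<close> vanishes.\<close>

lemma hajlasz_pointwise:
  assumes \<beta>: "0 < \<beta>" "\<beta> < Q" and u: "u \<in> Lip \<beta>" "\<And>v. v \<notin> ball x (2 * r) \<Longrightarrow> u v = 0"
    and g: "g \<in> hajlasz_gradients M \<beta> u"
    and r: "0 < r" "dist x z = 3 * r" "dist x y \<le> r" "5 * r \<le> dist a (b::'a)"
  shows "ennreal (u y) \<le> ennreal (2 * (4 powr \<beta> * K) * (1 + 5 powr Q) * (K / (1 - 2 powr (\<beta> - Q))))
    * riesz_potential M \<beta> g y"
proof -
  obtain N where [measurable]: "g \<in> borel_measurable M" and N: "N \<in> null_sets M"
    and grad: "\<And>v w. v \<notin> N \<Longrightarrow> w \<notin> N \<Longrightarrow>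
      ennreal \<bar>u v - u w\<bar> \<le> ennreal (dist v w powr \<beta>) * (g v + g w)"
    using g unfolding hajlasz_gradients_def by blast
  \<comment> \<open>As \<open>dist y z \<le> 4 * r\<close>, the ball of radius 5 r about y contains
    the ball of radius r about z, where the chain starts.\<close>
  define s where "s i = 5 * r / 2 ^ i" for i :: nat
  define G where "G i = (\<integral>\<^sup>+w. g w * indicator (ball y (s i)) w \<partial>M)" for i
  define e where "e i = ennreal (s i powr (\<beta> - Q)) * G i" for i
  define B where "B = 4 powr \<beta> * K"
  define A where "A = 2 * B * (1 + 5 powr Q)"
  have s_pos: "0 < s i" for i using r by (simp add: s_def)
  have s_le: "s i \<le> dist a b" for i
  proof -
    have "s i \<le> 5 * r" using r by (simp add: s_def field_simps)
    then show ?thesis using r by simp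
  qed
  have s_Suc: "s i = 2 * s (Suc i)" for i by (simp add: s_def)
  have B: "0 < B" using K_ge_1 by (simp add: B_def)
  have "\<exists>w\<in>ball y (s i) - N. g w \<le> ennreal (K * s i powr (-Q)) * G i" for i
    unfolding G_def by (rule exists_small_gradient[OF _ N s_pos s_le]) measurable
  then obtain w where w: "\<And>i. dist y (w i) < s i" "\<And>i. w i \<notin> N"
    "\<And>i. g (w i) \<le> ennreal (K * s i powr (-Q)) * G i"
    by (metis DiffE mem_ball)
  \<comment> \<open>Since \<open>dist x z = 3 * r\<close>, the ball of radius r about z misses
    \<open>ball x (2 * r)\<close>, so u v = 0.\<close>
  obtain v where v: "v \<in> ball z r" "v \<notin> N"
    and "g v \<le> ennreal (K * r powr (-Q)) * (\<integral>\<^sup>+w. g w * indicator (ball z r) w \<partial>M)"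
    using exists_small_gradient[of g N r a b z] N r by auto
  note this(3)
  also have "\<dots> \<le> ennreal (K * r powr (-Q)) * G 0"
    unfolding G_def
  proof (intro mult_left_mono nn_integral_mono)
    fix v
    have "dist y v < 5 * r" if "dist z v < r"
      using that r dist_triangle[of y v x] dist_triangle[of x v z] by (simp add: dist_commute)
    then show "indicator (ball z r) v \<le> (indicator (ball y (s 0)) v :: ennreal)"
      by (auto simp: indicator_def s_def)
  qed auto
  also have "K * r powr (-Q) = K * 5 powr Q * s 0 powr (-Q)"
    using r by (simp add: s_def powr_mult powr_minus)
  finally have gv: "g v \<le> ennreal (K * 5 powr Q * s 0 powr (-Q)) * G 0" .
  have scale: "ennreal ((c * s i) powr \<beta>) * (ennreal (k * s i powr (-Q)) * G i) = ennreal (c powr \<beta> * k) * e i"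
    if "0 \<le> c" "0 \<le> k" for c k i
  proof -
    have "(c * s i) powr \<beta> * (k * s i powr (-Q)) = c powr \<beta> * k * s i powr (\<beta> - Q)"
      using s_pos[of i] that by (simp add: powr_mult flip: powr_add)
    moreover have "ennreal ((c * s i) powr \<beta>) * (ennreal (k * s i powr (-Q)) * G i)
        = ennreal ((c * s i) powr \<beta> * (k * s i powr (-Q))) * G i"
      using that by (subst ennreal_mult) (auto simp: mult.assoc)
    moreover have "ennreal (c powr \<beta> * k * s i powr (\<beta> - Q)) * G i = ennreal (c powr \<beta> * k) * e i"
      using that by (subst ennreal_mult) (auto simp: e_def mult.assoc)
    ultimately show ?thesis by (simp only:)
  qed
  \<comment> \<open>The spare term in \<open>e n\<close> pays in advance for half of the next step,
    which costs B times \<open>e n + e (Suc n)\<close>. Each \<open>e i\<close> is thus charged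
    twice, and \<open>e 0\<close> also for the jump from v, which brings in 5^Q.\<close>
  have claim: "ennreal \<bar>u (w n)\<bar> + ennreal B * e n \<le> ennreal A * (\<Sum>i\<le>n. e i)" for n
  proof (induction n)
    case 0
    have "v \<notin> ball x (2 * r)"
      using v r dist_triangle[of x z v] by (auto simp: dist_commute)
    then have "ennreal \<bar>u (w 0)\<bar> = ennreal \<bar>u (w 0) - u v\<bar>" using u(2) by simp
    also have "\<dots> \<le> ennreal (dist (w 0) v powr \<beta>) * (g (w 0) + g v)" by (rule grad[OF w(2) v(2)])
    also have "\<dots> \<le> ennreal ((4 * s 0) powr \<beta>) * (ennreal (K * s 0 powr (-Q)) * G 0 + ennreal (K * 5 powr Q * s 0 powr (-Q)) * G 0)"
    proof (intro mult_mono add_mono w(3) gv ennreal_leI powr_mono2)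
      \<comment> \<open>The jump is shorter than 10 r. The cruder bound 4 s_0 = 20 r yields the
        factor \<open>4 powr \<beta>\<close> that also suits the later steps, where 2 s_n = 4
        s_(n+1).\<close>
      have "dist (w 0) v \<le> dist y (w 0) + dist y x + dist x z + dist z v"
        using dist_triangle[of "w 0" v y] dist_triangle[of y v x] dist_triangle[of x v z] by (simp add: dist_commute)
      then show "dist (w 0) v \<le> 4 * s 0"
        using w(1)[of 0] v r by (simp add: s_def dist_commute)
    qed (use \<beta> in auto)
    also have "\<dots> = ennreal B * e 0 + ennreal (B * 5 powr Q) * e 0"
      using scale[of 4 K 0] scale[of 4 "K * 5 powr Q" 0] K_ge_1 by (simp add: distrib_left B_def mult.assoc)
    finally have "ennreal \<bar>u (w 0)\<bar> + ennreal B * e 0 \<le> ennreal B * e 0 + ennreal (B * 5 powr Q) * e 0 + ennreal B * e 0"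
      by (rule add_right_mono)
    also have "\<dots> = ennreal (B + B * 5 powr Q + B) * e 0"
      using B by (subst ennreal_add_mult, simp, simp, subst ennreal_add_mult) auto
    also have "\<dots> \<le> ennreal A * e 0"
      using B by (intro mult_right_mono ennreal_leI) (auto simp: A_def algebra_simps)
    finally show ?case by simp
  next
    case (Suc n)
    have "ennreal \<bar>u (w n) - u (w (Suc n))\<bar> \<le> ennreal (dist (w n) (w (Suc n)) powr \<beta>) * (g (w n) + g (w (Suc n)))"
      by (rule grad[OF w(2) w(2)])
    also have "\<dots> \<le> ennreal ((2 * s n) powr \<beta>) * (g (w n) + g (w (Suc n)))"
      using w(1)[of n] w(1)[of "Suc n"] s_Suc[of n] s_pos[of "Suc n"] \<beta> dist_triangle2[of "w n" "w (Suc n)" y]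
      by (intro mult_right_mono ennreal_leI powr_mono2) (auto simp: dist_commute)
    also have "\<dots> = ennreal ((2 * s n) powr \<beta>) * g (w n) + ennreal ((4 * s (Suc n)) powr \<beta>) * g (w (Suc n))"
      by (simp add: distrib_left s_Suc[of n])
    also have "\<dots> \<le> ennreal ((4 * s n) powr \<beta>) * (ennreal (K * s n powr (-Q)) * G n)
        + ennreal ((4 * s (Suc n)) powr \<beta>) * (ennreal (K * s (Suc n) powr (-Q)) * G (Suc n))"
      using s_pos[of n] \<beta> by (intro add_mono mult_mono w(3) ennreal_leI powr_mono2 order_refl) auto
    also have "\<dots> = ennreal B * e n + ennreal B * e (Suc n)"
      using scale[of 4 K n] scale[of 4 K "Suc n"] K_ge_1 by (simp add: B_def)
    finally have diff: "ennreal \<bar>u (w n) - u (w (Suc n))\<bar> \<le> ennreal B * e n + ennreal B * e (Suc n)" .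
    have "ennreal \<bar>u (w (Suc n))\<bar> \<le> ennreal (\<bar>u (w n)\<bar> + \<bar>u (w n) - u (w (Suc n))\<bar>)"
      by (intro ennreal_leI) linarith
    also have "\<dots> = ennreal \<bar>u (w n)\<bar> + ennreal \<bar>u (w n) - u (w (Suc n))\<bar>" by simp
    also have "\<dots> \<le> ennreal \<bar>u (w n)\<bar> + (ennreal B * e n + ennreal B * e (Suc n))"
      by (intro add_left_mono diff)
    finally have "ennreal \<bar>u (w (Suc n))\<bar> + ennreal B * e (Suc n)
        \<le> ennreal \<bar>u (w n)\<bar> + (ennreal B * e n + ennreal B * e (Suc n)) + ennreal B * e (Suc n)"
      by (rule add_right_mono)
    also have "\<dots> = (ennreal \<bar>u (w n)\<bar> + ennreal B * e n) + ennreal (B + B) * e (Suc n)"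
      using B by (subst ennreal_add_mult) (auto simp: add.assoc)
    also have "\<dots> \<le> ennreal A * (\<Sum>i\<le>n. e i) + ennreal A * e (Suc n)"
      using B by (intro add_mono Suc.IH mult_right_mono ennreal_leI) (auto simp: A_def algebra_simps)
    also have "\<dots> = ennreal A * (\<Sum>i\<le>Suc n. e i)" by (simp add: distrib_left)
    finally show ?case .
  qed
  have c: "0 < 1 - 2 powr (\<beta> - Q)" using \<beta> by (simp add: powr_less_one)
  let ?R = "ennreal (A * (K / (1 - 2 powr (\<beta> - Q)))) * riesz_potential M \<beta> g y"
  have bound: "ennreal \<bar>u (w n)\<bar> \<le> ?R" for n
  proof -
    have "ennreal \<bar>u (w n)\<bar> \<le> ennreal \<bar>u (w n)\<bar> + ennreal B * e n" by simp
    also have "\<dots> \<le> ennreal A * (\<Sum>i\<le>n. e i)" by (rule claim)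
    also have "\<dots> \<le> ennreal A * (ennreal (K / (1 - 2 powr (\<beta> - Q))) * riesz_potential M \<beta> g y)"
      unfolding e_def G_def s_def using \<beta> by (intro mult_left_mono sum_averages_le_riesz) auto
    also have "\<dots> = ?R"
      using B c K_ge_1 by (subst ennreal_mult) (auto simp: A_def mult.assoc)
    finally show ?thesis .
  qed
  \<comment> \<open>The point y may lie in N, where the gradient inequality says nothing. Hoelder
    continuity of u transfers the bound from the points \<open>w n\<close>, which tend to y.\<close>
  obtain \<kappa> where \<kappa>: "0 \<le> \<kappa>" "\<And>v w. \<bar>u v - u w\<bar> \<le> \<kappa> * dist v w powr \<beta>"
    using u(1) by (auto simp: Lip_def)
  have "ennreal (u y) \<le> ?R"
  proof (rule ennreal_le_epsilon)
    fix \<epsilon> :: real assume "0 < \<epsilon>"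
    then have "\<forall>\<^sub>F n in sequentially. \<kappa> * s n powr \<beta> < \<epsilon>"
      using tendsto_dyadic_powr[of \<beta> "5 * r" \<kappa>] r \<beta> unfolding s_def by (intro order_tendstoD) auto
    then obtain n where n: "\<kappa> * s n powr \<beta> < \<epsilon>" by (auto simp: eventually_sequentially)
    have "\<kappa> * dist y (w n) powr \<beta> \<le> \<kappa> * s n powr \<beta>"
      using \<kappa> w(1)[of n] \<beta> by (intro mult_left_mono powr_mono2) auto
    then have "u y \<le> \<bar>u (w n)\<bar> + \<epsilon>" using \<kappa>(2)[of y "w n"] n by linarith
    then have "ennreal (u y) \<le> ennreal (\<bar>u (w n)\<bar> + \<epsilon>)" by (rule ennreal_leI)
    also have "\<dots> = ennreal \<bar>u (w n)\<bar> + ennreal \<epsilon>" using \<open>0 < \<epsilon>\<close> by simp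
    also have "\<dots> \<le> ?R + ennreal \<epsilon>" by (intro add_right_mono bound)
    finally show "ennreal (u y) \<le> ?R + ennreal \<epsilon>" .
  qed
  then show ?thesis by (simp only: A_def B_def)
qed

lemma riesz_capacity_le_hajlasz_capacity:
  assumes "0 < \<beta>" "\<beta> < Q" "0 < p"
  shows "\<exists>C>0. \<forall>F x r z a b. 0 < r \<longrightarrow> dist x z = 3 * r \<longrightarrow> 5 * r \<le> dist a (b::'a) \<longrightarrow> F \<subseteq> cball x r \<longrightarrow>
    riesz_capacity M \<beta> p F \<le> ennreal C * hajlasz_capacity M \<beta> p F (ball x (2 * r))"
proof -
  define D where "D = 2 * (4 powr \<beta> * K) * (1 + 5 powr Q) * (K / (1 - 2 powr (\<beta> - Q)))"
  have "0 < 1 - 2 powr (\<beta> - Q)" using assms by (simp add: powr_less_one)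
  then have D: "0 < D" using K_ge_1 by (auto simp: D_def intro!: mult_pos_pos divide_pos_pos add_pos_pos)
  have "riesz_capacity M \<beta> p F \<le> ennreal (D powr p) * hajlasz_capacity M \<beta> p F (ball x (2 * r))"
    if H: "0 < r" "dist x z = 3 * r" "5 * r \<le> dist a b" "F \<subseteq> cball x r" for F x r z and a b :: 'a
  proof -
    have main: "riesz_capacity M \<beta> p F \<le> ennreal (D powr p) * (\<integral>\<^sup>+x. ennreal_powr (g x) p \<partial>M)"
      if u: "u \<in> Lip \<beta>" "\<forall>y\<in>F. 1 \<le> u y" "\<forall>y\<in>-ball x (2 * r). u y = 0" and g: "g \<in> hajlasz_gradients M \<beta> u" for u g
    proof -
      have [measurable]: "g \<in> borel_measurable M" using g by (simp add: hajlasz_gradients_def)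
      let ?f = "\<lambda>w. ennreal D * g w"
      have "1 \<le> riesz_potential M \<beta> ?f y" if "y \<in> F" for y
      proof -
        have "1 \<le> ennreal (u y)" using u(2) that by simp
        also have "\<dots> \<le> ennreal D * riesz_potential M \<beta> g y"
          unfolding D_def using that H u by (intro hajlasz_pointwise[OF assms(1,2) u(1) _ g, of x r z y a b]) auto
        also have "\<dots> = riesz_potential M \<beta> ?f y"
          unfolding riesz_potential_def
          by (subst nn_integral_cmult[symmetric]) (auto simp: emeasure_ball mult.assoc ennreal_times_divide)
        finally show ?thesis .
      qed
      then have "riesz_capacity M \<beta> p F \<le> (\<integral>\<^sup>+y. ennreal_powr (?f y) p \<partial>M)"
        unfolding riesz_capacity_def by (intro INF_lower) auto
      also have "\<dots> = ennreal (D powr p) * (\<integral>\<^sup>+x. ennreal_powr (g x) p \<partial>M)"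
        using D assms by (simp add: ennreal_powr_mult nn_integral_cmult)
      finally show ?thesis .
    qed
    \<comment> \<open>With the constant on the left it suffices to bound every competitor, and an
      empty infimum is covered as well.\<close>
    have "ennreal (inverse (D powr p)) * riesz_capacity M \<beta> p F \<le> hajlasz_capacity M \<beta> p F (ball x (2 * r))"
      unfolding hajlasz_capacity_def
    proof (intro INF_greatest)
      fix u g assume "u \<in> {u \<in> Lip \<beta>. (\<forall>x\<in>F. 1 \<le> u x) \<and> (\<forall>x\<in>- ball x (2 * r). u x = 0)}"
        and "g \<in> hajlasz_gradients M \<beta> u"
      then have "ennreal (inverse (D powr p)) * riesz_capacity M \<beta> p F
        \<le> ennreal (inverse (D powr p)) * (ennreal (D powr p) * (\<integral>\<^sup>+x. ennreal_powr (g x) p \<partial>M))"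
        by (intro mult_left_mono main) auto
      also have "\<dots> = (\<integral>\<^sup>+x. ennreal_powr (g x) p \<partial>M)"
        using D by (simp add: mult.assoc[symmetric] flip: ennreal_mult)
      finally show "ennreal (inverse (D powr p)) * riesz_capacity M \<beta> p F \<le> (\<integral>\<^sup>+x. ennreal_powr (g x) p \<partial>M)" .
    qed
    then have "ennreal (D powr p) * (ennreal (inverse (D powr p)) * riesz_capacity M \<beta> p F)
      \<le> ennreal (D powr p) * hajlasz_capacity M \<beta> p F (ball x (2 * r))" by (intro mult_left_mono) auto
    then show ?thesis using D by (simp add: mult.assoc[symmetric] flip: ennreal_mult)
  qed
  moreover have "0 < D powr p" using D by simp
  ultimately show ?thesis by blast
qed

section \<open>Riesz potentials by dyadic scales\<close>

lemma ball_integral_young: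
  assumes [measurable]: "f \<in> borel_measurable M" and "0 < a" "1 < p" "0 < t"
  shows "(\<integral>\<^sup>+w. f w * indicator (ball y t) w \<partial>M)
    \<le> ennreal (a * (K * t powr Q)) + ennreal (a powr (1 - p)) * (\<integral>\<^sup>+w. ennreal_powr (f w) p \<partial>M)"
proof -
  have "(\<integral>\<^sup>+w. f w * indicator (ball y t) w \<partial>M)
    \<le> (\<integral>\<^sup>+w. ennreal a * indicator (ball y t) w + ennreal (a powr (1 - p)) * ennreal_powr (f w) p \<partial>M)"
    using ennreal_le_young[OF assms(2,3)] by (intro nn_integral_mono) (auto simp: indicator_def)
  also have "\<dots> = ennreal a * emeasure M (ball y t) + ennreal (a powr (1 - p)) * (\<integral>\<^sup>+w. ennreal_powr (f w) p \<partial>M)"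
    by (simp add: nn_integral_add nn_integral_cmult nn_integral_cmult_indicator)
  also have "ennreal a * emeasure M (ball y t) \<le> ennreal a * ennreal (K * t powr Q)"
    using measure_ball_le[OF \<open>0 < t\<close>, of y] by (intro mult_left_mono) (auto simp: emeasure_ball ennreal_leI)
  also have "\<dots> = ennreal (a * (K * t powr Q))" using assms K_ge_1 by (simp flip: ennreal_mult)
  finally show ?thesis by (simp add: add_mono)
qed

text \<open>The radius \<open>dist y w\<close> is itself a distance in the space, so the lower
  regularity bound applies to it however large it is.\<close>

lemma riesz_kernel_le:
  assumes "0 < \<beta>" "\<beta> < Q"
  shows "ennreal (dist y w powr \<beta>) / emeasure M (ball y (dist y w)) \<le> ennreal (K * dist y w powr (\<beta> - Q))"
proof (cases "y = w")
  case False
  let ?d = "dist y w"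
  have d: "0 < ?d" using False by simp
  have m: "0 < measure M (ball y ?d)" by (rule measure_ball_pos[OF d])
  have "?d powr \<beta> = ?d powr (\<beta> - Q) * ?d powr Q" using d by (simp flip: powr_add)
  also have "\<dots> \<le> ?d powr (\<beta> - Q) * (K * measure M (ball y ?d))"
    using measure_ball_ge[OF d order_refl, of y] by (intro mult_left_mono) auto
  finally have "?d powr \<beta> / measure M (ball y ?d) \<le> K * ?d powr (\<beta> - Q)" using m by (simp add: field_simps)
  then show ?thesis using m by (simp add: emeasure_ball divide_ennreal ennreal_leI)
qed (use assms in simp)

text \<open>A smoothed mass of f near y, between the masses in the balls of radius s and 2 s; for
  integrable f it is Lipschitz in y.\<close>

definition bump_integral :: "('a \<Rightarrow> ennreal) \<Rightarrow> real \<Rightarrow> 'a \<Rightarrow> ennreal" where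
  "bump_integral f s y = (\<integral>\<^sup>+w. f w * ennreal (bump (dist y w / s)) \<partial>M)"

lemma measurable_bump [measurable]: "(\<lambda>w. bump (dist y w / s)) \<in> borel_measurable M"
  unfolding bump_def by measurable

text \<open>Each w is assigned to one of the two sums by comparing its distance with \<rho>. The
  small scales have to dominate the kernel only where f' = f, and values of f' farther out merely
  enlarge the right side; this permits a cutoff of f.\<close>

lemma riesz_potential_le_near_far:
  assumes [measurable]: "f \<in> borel_measurable M" "f' \<in> borel_measurable M"
    and \<beta>: "0 < \<beta>" "\<beta> < Q" and "0 < \<rho>" and f': "\<And>w. dist y w < \<rho> \<Longrightarrow> f' w = f w"
  shows "riesz_potential M \<beta> f y \<le> ennreal (K * 2 powr (Q - \<beta>)) *
    ((\<Sum>i. ennreal ((\<rho> / 2 ^ i) powr (\<beta> - Q)) * bump_integral f' (\<rho> / 2 ^ i) y) +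
     (\<Sum>i. ennreal ((\<rho> * 2 ^ Suc i) powr (\<beta> - Q)) * (\<integral>\<^sup>+w. f w * indicator (ball y (\<rho> * 2 ^ Suc i)) w \<partial>M)))"
proof -
  define near where "near w = (\<Sum>i. ennreal ((\<rho> / 2 ^ i) powr (\<beta> - Q)) * (f' w * ennreal (bump (dist y w / (\<rho> / 2 ^ i)))))" for w
  define far where "far w = (\<Sum>i. ennreal ((\<rho> * 2 ^ Suc i) powr (\<beta> - Q)) * (f w * indicator (ball y (\<rho> * 2 ^ Suc i)) w))" for w
  have [measurable]: "near \<in> borel_measurable M" "far \<in> borel_measurable M"
    unfolding near_def far_def by measurable
  have "riesz_potential M \<beta> f y \<le> (\<integral>\<^sup>+w. ennreal (K * 2 powr (Q - \<beta>)) * (near w + far w) \<partial>M)"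
    unfolding riesz_potential_def
  proof (intro nn_integral_mono)
    fix w
    let ?d = "dist y w"
    define k where "k = (if ?d < \<rho> then (\<Sum>i. ennreal ((\<rho> / 2 ^ i) powr (\<beta> - Q)) * ennreal (bump (?d / (\<rho> / 2 ^ i))))
     else (\<Sum>i. ennreal ((\<rho> * 2 ^ Suc i) powr (\<beta> - Q)) * indicator {..<\<rho> * 2 ^ Suc i} ?d))"
    have "ennreal (?d powr \<beta>) / emeasure M (ball y ?d) \<le> ennreal (K * ?d powr (\<beta> - Q))"
      by (rule riesz_kernel_le[OF \<beta>])
    also have "\<dots> = ennreal K * ennreal (?d powr (\<beta> - Q))"
      using K_ge_1 by (intro ennreal_mult) auto
    also have "\<dots> \<le> ennreal K * (ennreal (2 powr (Q - \<beta>)) * k)"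
    proof (cases "y = w")
      case False
      then have "0 < ?d" by simp
      moreover have "0 < Q - \<beta>" using \<beta> by simp
      ultimately have "ennreal (?d powr (\<beta> - Q)) \<le> ennreal (2 powr (Q - \<beta>)) * k"
        using powr_le_dyadic_scales[OF \<open>0 < \<rho>\<close>, of ?d "Q - \<beta>"] unfolding minus_diff_eq k_def by blast
      then show ?thesis by (intro mult_left_mono) auto
    qed simp
    finally have "f w * (ennreal (?d powr \<beta>) / emeasure M (ball y ?d)) \<le> f w * (ennreal K * (ennreal (2 powr (Q - \<beta>)) * k))"
      by (intro mult_left_mono) auto
    also have "\<dots> = ennreal (K * 2 powr (Q - \<beta>)) * (f w * k)"
      using K_ge_1 by (subst ennreal_mult) (auto simp: mult_ac)
    also have "f w * k \<le> near w + far w"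
    proof (cases "?d < \<rho>")
      case True
      have "f' w * (\<Sum>i. ennreal ((\<rho> / 2 ^ i) powr (\<beta> - Q)) * ennreal (bump (?d / (\<rho> / 2 ^ i)))) = near w"
        unfolding near_def by (subst ennreal_suminf_cmult[symmetric]) (simp only: mult.left_commute)
      then have "f w * k = near w" unfolding k_def using True f'[OF True] by (simp only: if_True)
      then show ?thesis by simp
    next
      case False
      have "f w * (\<Sum>i. ennreal ((\<rho> * 2 ^ Suc i) powr (\<beta> - Q)) * indicator {..<\<rho> * 2 ^ Suc i} ?d)
          = (\<Sum>i. ennreal ((\<rho> * 2 ^ Suc i) powr (\<beta> - Q)) * (f w * indicator {..<\<rho> * 2 ^ Suc i} ?d))"
        by (subst ennreal_suminf_cmult[symmetric]) (simp only: mult.left_commute)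
      also have "\<dots> = far w" by (simp add: far_def indicator_def)
      finally have "f w * k = far w" unfolding k_def using False by (simp only: if_False)
      then show ?thesis by simp
    qed
    finally show "f w * ennreal (?d powr \<beta>) / emeasure M (ball y ?d) \<le> ennreal (K * 2 powr (Q - \<beta>)) * (near w + far w)"
      by (simp add: ennreal_times_divide mult_left_mono)
  qed
  also have "\<dots> = ennreal (K * 2 powr (Q - \<beta>)) * ((\<integral>\<^sup>+w. near w \<partial>M) + (\<integral>\<^sup>+w. far w \<partial>M))"
    by (simp add: nn_integral_cmult nn_integral_add)
  also have "(\<integral>\<^sup>+w. near w \<partial>M) = (\<Sum>i. ennreal ((\<rho> / 2 ^ i) powr (\<beta> - Q)) * bump_integral f' (\<rho> / 2 ^ i) y)"
    unfolding near_def bump_integral_def by (subst nn_integral_suminf, measurable) (subst nn_integral_cmult, measurable)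
  also have "(\<integral>\<^sup>+w. far w \<partial>M) = (\<Sum>i. ennreal ((\<rho> * 2 ^ Suc i) powr (\<beta> - Q)) * (\<integral>\<^sup>+w. f w * indicator (ball y (\<rho> * 2 ^ Suc i)) w \<partial>M))"
    unfolding far_def by (subst nn_integral_suminf, measurable) (subst nn_integral_cmult, measurable)
  finally show ?thesis .
qed

text \<open>Young's inequality with a parameter \<open>a\<close> proportional to \<open>t\<^bsup>- Q / p\<^esup>\<close> on the ball of radius \<open>t\<close> makes
  both resulting terms decay like \<open>t\<^bsup>\<beta> - Q / p\<^esup>\<close>.\<close>

lemma far_scales_le:
  assumes [measurable]: "f \<in> borel_measurable M" and "1 < p" "\<beta> * p < Q" "0 < \<rho>" "0 < \<epsilon>"
  shows "(\<Sum>i. ennreal ((\<rho> * 2 ^ Suc i) powr (\<beta> - Q)) * (\<integral>\<^sup>+w. f w * indicator (ball y (\<rho> * 2 ^ Suc i)) w \<partial>M))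
    \<le> ennreal (1 / (1 - 2 powr (\<beta> - Q / p))) *
      (ennreal (K * \<epsilon>) + ennreal (\<epsilon> powr (1 - p) * \<rho> powr (\<beta> * p - Q)) * (\<integral>\<^sup>+w. ennreal_powr (f w) p \<partial>M))"
    (is "_ \<le> _ * ?R")
proof -
  define \<theta> where "\<theta> = 2 powr (\<beta> - Q / p)"
  define N where "N = (\<integral>\<^sup>+w. ennreal_powr (f w) p \<partial>M)"
  \<comment> \<open>Here \<open>\<beta> * p < Q\<close> enters: it makes \<beta> - Q / p
    negative.\<close>
  have \<theta>: "0 < \<theta>" "\<theta> < 1" using assms by (auto simp: \<theta>_def powr_less_one field_simps)
  have "ennreal ((\<rho> * 2 ^ Suc i) powr (\<beta> - Q)) * (\<integral>\<^sup>+w. f w * indicator (ball y (\<rho> * 2 ^ Suc i)) w \<partial>M)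
      \<le> ennreal (\<theta> ^ Suc i) * ?R" for i
  proof -
    define \<tau> :: real where "\<tau> = 2 ^ Suc i"
    \<comment> \<open>The factor \<open>\<rho> powr (-\<beta>)\<close> frees the first Young term of
      \<rho>; the second then carries \<open>\<rho> powr (\<beta> * p - Q)\<close>, to be offset by
      the bound on the energy of f.\<close>
    define a where "a = \<epsilon> * \<rho> powr (-\<beta>) * \<tau> powr (-(Q / p))"
    have \<tau>: "0 < \<tau>" by (simp add: \<tau>_def)
    have a: "0 < a" using assms \<tau> by (simp add: a_def)
    have pow: "\<tau> powr (\<beta> - Q / p) = \<theta> ^ Suc i"
      unfolding \<tau>_def \<theta>_def by (simp only: powr_realpow[symmetric] zero_less_numeral powr_powr powr_gt_zero) (simp add: mult.commute)
    have 1: "(\<rho> * \<tau>) powr (\<beta> - Q) * (a * (K * (\<rho> * \<tau>) powr Q)) = \<tau> powr (\<beta> - Q / p) * (K * \<epsilon>)"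
    proof -
      have "(\<rho> * \<tau>) powr (\<beta> - Q) * (\<rho> * \<tau>) powr Q * (\<rho> powr (-\<beta>) * \<tau> powr (-(Q / p))) = \<tau> powr (\<beta> - Q / p)"
        using assms \<tau> by (simp add: powr_def ln_mult flip: exp_add) (simp add: algebra_simps)
      then show ?thesis by (simp add: a_def mult_ac)
    qed
    have 2: "(\<rho> * \<tau>) powr (\<beta> - Q) * a powr (1 - p) = \<tau> powr (\<beta> - Q / p) * (\<epsilon> powr (1 - p) * \<rho> powr (\<beta> * p - Q))"
      using assms \<tau> by (simp add: a_def powr_def ln_mult flip: exp_add) (simp add: field_simps)
    have "ennreal ((\<rho> * \<tau>) powr (\<beta> - Q)) * (\<integral>\<^sup>+w. f w * indicator (ball y (\<rho> * \<tau>)) w \<partial>M)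
      \<le> ennreal ((\<rho> * \<tau>) powr (\<beta> - Q)) * (ennreal (a * (K * (\<rho> * \<tau>) powr Q)) + ennreal (a powr (1 - p)) * N)"
      unfolding N_def using assms \<tau> a by (intro mult_left_mono ball_integral_young) auto
    also have "\<dots> = ennreal ((\<rho> * \<tau>) powr (\<beta> - Q) * (a * (K * (\<rho> * \<tau>) powr Q)))
        + ennreal ((\<rho> * \<tau>) powr (\<beta> - Q) * a powr (1 - p)) * N"
      using a K_ge_1 by (subst (1 2) ennreal_mult) (auto simp: distrib_left mult.assoc)
    also have "\<dots> = ennreal (\<tau> powr (\<beta> - Q / p)) * (ennreal (K * \<epsilon>) + ennreal (\<epsilon> powr (1 - p) * \<rho> powr (\<beta> * p - Q)) * N)"
      unfolding 1 2 using assms K_ge_1 by (subst (1 2) ennreal_mult) (auto simp: distrib_left mult.assoc)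
    finally show ?thesis by (simp only: pow \<tau>_def[symmetric] N_def)
  qed
  then have "(\<Sum>i. ennreal ((\<rho> * 2 ^ Suc i) powr (\<beta> - Q)) * (\<integral>\<^sup>+w. f w * indicator (ball y (\<rho> * 2 ^ Suc i)) w \<partial>M))
      \<le> (\<Sum>i. ennreal (\<theta> ^ Suc i) * ?R)"
    by (intro suminf_le) auto
  also have "\<dots> = (\<Sum>i. ennreal (\<theta> ^ Suc i)) * ?R" by (rule ennreal_suminf_multc)
  also have "\<dots> \<le> ennreal (1 / (1 - \<theta>)) * ?R"
  proof (intro mult_right_mono)
    have "(\<lambda>i. \<theta> * \<theta> ^ i) sums (\<theta> * (1 / (1 - \<theta>)))" using \<theta> by (intro sums_mult geometric_sums) auto
    then have "(\<Sum>i. ennreal (\<theta> ^ Suc i)) = ennreal (\<theta> * (1 / (1 - \<theta>)))"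
      using \<theta> by (intro suminf_ennreal_eq) auto
    also have "\<dots> \<le> ennreal (1 / (1 - \<theta>))"       using \<theta> mult_right_mono[of \<theta> 1 "1 / (1 - \<theta>)"] by (intro ennreal_leI) simp
    finally show "(\<Sum>i. ennreal (\<theta> ^ Suc i)) \<le> ennreal (1 / (1 - \<theta>))" .
  qed auto
  finally show ?thesis by (simp only: \<theta>_def)
qed

section \<open>Regularity of partial sums over small scales\<close>

lemma bump_integral_diff:
  assumes [measurable]: "f \<in> borel_measurable M" and "0 < s"
  shows "bump_integral f s y \<le> bump_integral f s z + ennreal (min 1 (dist y z / s)) *
    ((\<integral>\<^sup>+w. f w * indicator (ball y (2 * s)) w \<partial>M) + (\<integral>\<^sup>+w. f w * indicator (ball z (2 * s)) w \<partial>M))"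
proof -
  let ?m = "min 1 (dist y z / s)"
  have m: "0 \<le> ?m" using assms by simp
  have "bump_integral f s y \<le> (\<integral>\<^sup>+w. f w * ennreal (bump (dist z w / s))
      + ennreal ?m * (f w * indicator (ball y (2 * s)) w + f w * indicator (ball z (2 * s)) w) \<partial>M)"
    unfolding bump_integral_def
  proof (intro nn_integral_mono)
    fix w
    have "ennreal (bump (dist y w / s)) \<le> ennreal (bump (dist z w / s)
        + ?m * (indicator (ball y (2 * s)) w + indicator (ball z (2 * s)) w))"
      using bump_dist_diff_ball[OF assms(2), of y w z] by (rule ennreal_leI)
    also have "\<dots> = ennreal (bump (dist z w / s)) + ennreal ?m * (indicator (ball y (2 * s)) w + indicator (ball z (2 * s)) w)"
      using m bump_nonneg[of "dist z w / s"] by (simp add: ennreal_mult ennreal_indicator)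
    finally have "f w * ennreal (bump (dist y w / s)) \<le> f w * (ennreal (bump (dist z w / s)) + ennreal ?m * (indicator (ball y (2 * s)) w + indicator (ball z (2 * s)) w))"
      by (intro mult_left_mono) auto
    then show "f w * ennreal (bump (dist y w / s)) \<le> f w * ennreal (bump (dist z w / s))
      + ennreal ?m * (f w * indicator (ball y (2 * s)) w + f w * indicator (ball z (2 * s)) w)"
      by (simp only: distrib_left mult.left_commute)
  qed
  also have "\<dots> = bump_integral f s z + ennreal ?m *
    ((\<integral>\<^sup>+w. f w * indicator (ball y (2 * s)) w \<partial>M) + (\<integral>\<^sup>+w. f w * indicator (ball z (2 * s)) w \<partial>M))"
    unfolding bump_integral_def
    by (subst nn_integral_add, measurable) (subst nn_integral_cmult, measurable, subst nn_integral_add, measurable)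
  finally show ?thesis .
qed

definition smooth_potential :: "real \<Rightarrow> real \<Rightarrow> nat \<Rightarrow> ('a \<Rightarrow> ennreal) \<Rightarrow> 'a \<Rightarrow> ennreal" where
  "smooth_potential \<beta> \<rho> n f y = (\<Sum>i<n. ennreal ((\<rho> / 2 ^ i) powr (\<beta> - Q)) * bump_integral f (\<rho> / 2 ^ i) y)"

text \<open>The mass bound on balls is left abstract because two choices occur: \<open>J i\<close>
  of order s^Q with A a maximal function gives a gradient, a constant J with A = 1 a Lipschitz
  bound.\<close>

lemma smooth_potential_diff:
  assumes [measurable]: "f \<in> borel_measurable M" and "0 < \<rho>"
    and I: "\<And>i y. (\<integral>\<^sup>+w. f w * indicator (ball y (2 * (\<rho> / 2 ^ i))) w \<partial>M) \<le> ennreal (J i) * A y"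
    and J: "\<And>i. 0 \<le> J i"
  shows "smooth_potential \<beta> \<rho> n f y \<le> smooth_potential \<beta> \<rho> n f z +
    ennreal (\<Sum>i<n. (\<rho> / 2 ^ i) powr (\<beta> - Q) * (min 1 (dist y z / (\<rho> / 2 ^ i)) * J i)) * (A y + A z)"
proof -
  let ?s = "\<lambda>i. \<rho> / 2 ^ i"
  let ?m = "\<lambda>i. min 1 (dist y z / ?s i)"
  have m: "0 \<le> ?m i" for i using assms(2) by simp
  have "smooth_potential \<beta> \<rho> n f y \<le> (\<Sum>i<n. ennreal (?s i powr (\<beta> - Q)) *
      (bump_integral f (?s i) z + ennreal (?m i) * (ennreal (J i) * A y + ennreal (J i) * A z)))"
    unfolding smooth_potential_def
  proof (intro sum_mono mult_left_mono)
    fix i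
    have "bump_integral f (?s i) y \<le> bump_integral f (?s i) z + ennreal (?m i) *
      ((\<integral>\<^sup>+w. f w * indicator (ball y (2 * ?s i)) w \<partial>M) + (\<integral>\<^sup>+w. f w * indicator (ball z (2 * ?s i)) w \<partial>M))"
      using assms(2) by (intro bump_integral_diff) auto
    also have "\<dots> \<le> bump_integral f (?s i) z + ennreal (?m i) * (ennreal (J i) * A y + ennreal (J i) * A z)"
      by (intro add_left_mono mult_left_mono add_mono I) auto
    finally show "bump_integral f (?s i) y \<le> bump_integral f (?s i) z + ennreal (?m i) * (ennreal (J i) * A y + ennreal (J i) * A z)" .
  qed auto
  also have "\<dots> = (\<Sum>i<n. ennreal (?s i powr (\<beta> - Q)) * bump_integral f (?s i) z
      + ennreal (?s i powr (\<beta> - Q) * (?m i * J i)) * (A y + A z))"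
  proof (intro sum.cong refl)
    fix i
    have "ennreal (?s i powr (\<beta> - Q) * (?m i * J i)) = ennreal (?s i powr (\<beta> - Q)) * (ennreal (?m i) * ennreal (J i))"
      using J[of i] m[of i] by (simp add: ennreal_mult)
    then show "ennreal (?s i powr (\<beta> - Q)) *
        (bump_integral f (?s i) z + ennreal (?m i) * (ennreal (J i) * A y + ennreal (J i) * A z))
      = ennreal (?s i powr (\<beta> - Q)) * bump_integral f (?s i) z + ennreal (?s i powr (\<beta> - Q) * (?m i * J i)) * (A y + A z)"
      by (simp only: distrib_left mult.assoc)
  qed
  also have "\<dots> = smooth_potential \<beta> \<rho> n f z + (\<Sum>i<n. ennreal (?s i powr (\<beta> - Q) * (?m i * J i))) * (A y + A z)"
    by (simp add: sum.distrib smooth_potential_def sum_distrib_right)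
  also have "(\<Sum>i<n. ennreal (?s i powr (\<beta> - Q) * (?m i * J i))) = ennreal (\<Sum>i<n. ?s i powr (\<beta> - Q) * (?m i * J i))"
    using J m by (intro sum_ennreal) auto
  finally show ?thesis .
qed

lemma smooth_potential_diff_maximal:
  assumes [measurable]: "f \<in> borel_measurable M" and "0 < \<rho>" "0 < \<beta>" "\<beta> < 1"
    and q: "\<And>k. 0 < q k" and cover: "\<And>i y. \<exists>k. q k = 4 * (\<rho> / 2 ^ i) \<and> dist (c k) y < 2 * (\<rho> / 2 ^ i)"
  shows "smooth_potential \<beta> \<rho> n f y \<le> smooth_potential \<beta> \<rho> n f z +
    ennreal (K * 4 powr Q * (1 / (1 - 2 powr (-\<beta>)) + 1 / (1 - 2 powr (\<beta> - 1))) * dist y z powr \<beta>) *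
    (maximal c q f y + maximal c q f z)"
proof -
  let ?s = "\<lambda>i. \<rho> / 2 ^ i"
  have s: "0 < ?s i" for i using assms by simp
  have I: "(\<integral>\<^sup>+w. f w * indicator (ball y (2 * ?s i)) w \<partial>M) \<le> ennreal (K * (4 * ?s i) powr Q) * maximal c q f y" for i y
  proof -
    \<comment> \<open>A ball of radius 4 s whose centre is within 2 s of y contains both y and
      \<open>ball y (2 * s)\<close>, so its average controls the integral.\<close>
    obtain k where k: "q k = 4 * ?s i" "dist (c k) y < 2 * ?s i" using cover by blast
    have "(\<integral>\<^sup>+w. f w * indicator (ball y (2 * ?s i)) w \<partial>M) \<le> (\<integral>\<^sup>+w. f w * indicator (ball (c k) (q k)) w \<partial>M)"
    proof (intro nn_integral_mono mult_left_mono)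
      fix w
      show "indicator (ball y (2 * ?s i)) w \<le> (indicator (ball (c k) (q k)) w :: ennreal)"
        using k dist_triangle[of "c k" w y] by (auto simp: indicator_def)
    qed auto
    also have "\<dots> \<le> emeasure M (ball (c k) (q k)) * maximal c q f y"
      using k q s[of i] by (intro ball_integral_le_maximal) auto
    also have "\<dots> \<le> ennreal (K * (4 * ?s i) powr Q) * maximal c q f y"
      using measure_ball_le[OF q, of "c k" k] k by (intro mult_right_mono) (auto simp: emeasure_ball ennreal_leI)
    finally show ?thesis .
  qed
  have "smooth_potential \<beta> \<rho> n f y \<le> smooth_potential \<beta> \<rho> n f z +
    ennreal (\<Sum>i<n. ?s i powr (\<beta> - Q) * (min 1 (dist y z / ?s i) * (K * (4 * ?s i) powr Q))) * (maximal c q f y + maximal c q f z)"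
    using K_ge_1 assms by (intro smooth_potential_diff I) auto
  also have "(\<Sum>i<n. ?s i powr (\<beta> - Q) * (min 1 (dist y z / ?s i) * (K * (4 * ?s i) powr Q)))
      = K * 4 powr Q * (\<Sum>i<n. ?s i powr \<beta> * min 1 (dist y z / ?s i))"
    unfolding sum_distrib_left
  proof (intro sum.cong refl)
    fix i
    have "?s i powr (\<beta> - Q) * (4 * ?s i) powr Q = 4 powr Q * ?s i powr \<beta>"
      using s[of i] by (simp only: powr_mult mult.left_commute) (simp flip: powr_add)
    then show "?s i powr (\<beta> - Q) * (min 1 (dist y z / ?s i) * (K * (4 * ?s i) powr Q))
      = K * 4 powr Q * (?s i powr \<beta> * min 1 (dist y z / ?s i))"
      by algebra
  qed
  also have "ennreal \<dots> \<le> ennreal (K * 4 powr Q * ((1 / (1 - 2 powr (-\<beta>)) + 1 / (1 - 2 powr (\<beta> - 1))) * dist y z powr \<beta>))"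
    using sum_dyadic_min_le[OF assms(2-4), of "dist y z" n] K_ge_1 by (intro ennreal_leI mult_left_mono) auto
  finally show ?thesis by (simp add: mult.assoc add_left_mono mult_right_mono)
qed

text \<open>The constants may grow with n, as they serve qualitative ends: finiteness, continuity
  and membership in \<open>Lip \<beta>\<close>.\<close>

lemma smooth_potential_finite:
  assumes [measurable]: "f \<in> borel_measurable M" and "0 < \<rho>" and fin: "(\<integral>\<^sup>+w. f w \<partial>M) = ennreal N" and "0 \<le> N"
  shows "\<exists>B. \<forall>y. smooth_potential \<beta> \<rho> n f y \<le> ennreal B"
    and "\<exists>L\<ge>0. \<forall>y z. smooth_potential \<beta> \<rho> n f y \<le> smooth_potential \<beta> \<rho> n f z + ennreal (L * dist y z)"
proof -
  let ?s = "\<lambda>i. \<rho> / 2 ^ i"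
  have s: "0 < ?s i" for i using assms by simp
  have "smooth_potential \<beta> \<rho> n f y \<le> ennreal (\<Sum>i<n. ?s i powr (\<beta> - Q) * N)" for y
  proof -
    have "smooth_potential \<beta> \<rho> n f y \<le> (\<Sum>i<n. ennreal (?s i powr (\<beta> - Q)) * ennreal N)"
      unfolding smooth_potential_def
    proof (intro sum_mono mult_left_mono)
      fix i
      have "f w * ennreal (bump (dist y w / ?s i)) \<le> f w * 1" for w
        using bump_le_1[of "dist y w / ?s i"] by (intro mult_left_mono) (auto simp: ennreal_le_1)
      then show "bump_integral f (?s i) y \<le> ennreal N"
        unfolding bump_integral_def fin[symmetric] by (intro nn_integral_mono) simp
    qed auto
    also have "\<dots> = ennreal (\<Sum>i<n. ?s i powr (\<beta> - Q) * N)"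
      using \<open>0 \<le> N\<close> by (simp flip: ennreal_mult sum_ennreal)
    finally show ?thesis .
  qed
  then show "\<exists>B. \<forall>y. smooth_potential \<beta> \<rho> n f y \<le> ennreal B" by blast
  define L where "L = (\<Sum>i<n. ?s i powr (\<beta> - Q) * (1 / ?s i * N)) * 2"
  have L: "0 \<le> L" unfolding L_def using \<open>0 \<le> N\<close> assms(2) by (intro mult_nonneg_nonneg sum_nonneg) auto
  have "smooth_potential \<beta> \<rho> n f y \<le> smooth_potential \<beta> \<rho> n f z + ennreal (L * dist y z)" for y z
  proof -
    have "smooth_potential \<beta> \<rho> n f y \<le> smooth_potential \<beta> \<rho> n f z +
      ennreal (\<Sum>i<n. ?s i powr (\<beta> - Q) * (min 1 (dist y z / ?s i) * N)) * (1 + 1)"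
    proof (rule smooth_potential_diff[where A = "\<lambda>_. 1" and J = "\<lambda>_. N"])
      show "(\<integral>\<^sup>+w. f w * indicator (ball y (2 * ?s i)) w \<partial>M) \<le> ennreal N * 1" for i y
        unfolding fin[symmetric] by (simp, intro nn_integral_mono) (simp add: indicator_def)
    qed (use assms in auto)
    also have "ennreal (\<Sum>i<n. ?s i powr (\<beta> - Q) * (min 1 (dist y z / ?s i) * N)) * (1 + 1)
        = ennreal ((\<Sum>i<n. ?s i powr (\<beta> - Q) * (min 1 (dist y z / ?s i) * N)) * 2)"
      by (subst ennreal_mult'') auto
    also have "\<dots> \<le> ennreal (L * dist y z)"
    proof (rule ennreal_leI)
      have "(\<Sum>i<n. ?s i powr (\<beta> - Q) * (min 1 (dist y z / ?s i) * N)) \<le> (\<Sum>i<n. ?s i powr (\<beta> - Q) * (1 / ?s i * N) * dist y z)"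
      proof (rule sum_mono)
        fix i
        have "?s i powr (\<beta> - Q) * (min 1 (dist y z / ?s i) * N) \<le> ?s i powr (\<beta> - Q) * (dist y z / ?s i * N)"
          using \<open>0 \<le> N\<close> by (intro mult_left_mono mult_right_mono) auto
        then show "?s i powr (\<beta> - Q) * (min 1 (dist y z / ?s i) * N) \<le> ?s i powr (\<beta> - Q) * (1 / ?s i * N) * dist y z"
          by (simp add: mult_ac)
      qed
      then show "(\<Sum>i<n. ?s i powr (\<beta> - Q) * (min 1 (dist y z / ?s i) * N)) * 2 \<le> L * dist y z"
        unfolding L_def sum_distrib_right[symmetric] by linarith
    qed
    finally show ?thesis by (simp add: add_left_mono)
  qed
  then show "\<exists>L\<ge>0. \<forall>y z. smooth_potential \<beta> \<rho> n f y \<le> smooth_potential \<beta> \<rho> n f z + ennreal (L * dist y z)"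
    using L by blast
qed

text \<open>A cutoff at scale r has differences at most min(1, d/r) \<le> (d/r)^\<beta>, so
  r^(-\<beta>) on the double ball is a gradient; its energy is r^(-\<beta>p) times a measure of
  order at most r^Q.\<close>

lemma hajlasz_capacity_le_cutoff:
  assumes "0 < \<beta>" "\<beta> \<le> 1" "1 < p" "0 < r" "F \<subseteq> cball x r"
  shows "hajlasz_capacity M \<beta> p F (ball x (2 * r)) \<le> ennreal (K * 2 powr Q * r powr (Q - \<beta> * p))"
proof -
  define u where "u y = bump (dist x y / r)" for y
  define g where "g y = ennreal (r powr (-\<beta>)) * indicator (ball x (2 * r)) y" for y
  have diff: "\<bar>u y - u z\<bar> \<le> min 1 (dist y z / r)" for y z
    using bump_dist_diff[OF \<open>0 < r\<close>, of y x z] by (simp add: u_def dist_commute)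
  have u0: "u y = 0" if "y \<notin> ball x (2 * r)" for y
    using that assms unfolding u_def by (intro bump_eq_0) (simp add: field_simps)
  have "u \<in> Lip \<beta>"
  proof (rule bounded_Lipschitz_in_Lip)
    show "\<bar>u y\<bar> \<le> 1" for y
      using bump_nonneg[of "dist x y / r"] bump_le_1[of "dist x y / r"] unfolding u_def by linarith
    show "\<bar>u y - u z\<bar> \<le> 1 / r * dist y z" for y z using diff[of y z] by simp
  qed (use assms in auto)
  moreover have "1 \<le> u y" if "y \<in> F" for y
    using that assms by (subst u_def, subst bump_eq_1) (auto simp: field_simps)
  moreover have "g \<in> hajlasz_gradients M \<beta> u"
    unfolding hajlasz_gradients_def
  proof (intro CollectI conjI bexI ballI)
    show "g \<in> borel_measurable M" unfolding g_def by measurable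
    show "ennreal \<bar>u y - u z\<bar> \<le> ennreal (dist y z powr \<beta>) * (g y + g z)" for y z
    proof (cases "y \<in> ball x (2 * r) \<or> z \<in> ball x (2 * r)")
      case True
      have "\<bar>u y - u z\<bar> \<le> min 1 (dist y z / r)" by (rule diff)
      also have "\<dots> \<le> (dist y z / r) powr \<beta>"
      proof (cases "dist y z / r \<le> 1")
        case True
        then show ?thesis using powr_mono'[of \<beta> 1 "dist y z / r"] assms by simp
      next
        case False
        then have "1 \<le> (dist y z / r) powr \<beta>" using assms by (intro ge_one_powr_ge_zero) auto
        then show ?thesis by simp
      qed
      also have "\<dots> = dist y z powr \<beta> * r powr (-\<beta>)"
        using assms by (simp add: powr_divide powr_minus) (simp add: divide_inverse)
      finally have "ennreal \<bar>u y - u z\<bar> \<le> ennreal (dist y z powr \<beta>) * ennreal (r powr (-\<beta>))"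
        by (simp add: ennreal_leI flip: ennreal_mult)
      also have "\<dots> \<le> ennreal (dist y z powr \<beta>) * (g y + g z)"
        using True by (intro mult_left_mono) (auto simp: g_def)
      finally show ?thesis .
    qed (simp add: u0)
  qed auto
  ultimately have "hajlasz_capacity M \<beta> p F (ball x (2 * r)) \<le> (\<integral>\<^sup>+y. ennreal_powr (g y) p \<partial>M)"
    unfolding hajlasz_capacity_def using u0 by (intro INF_lower2[of u] INF_lower) auto
  also have "\<dots> = (\<integral>\<^sup>+y. ennreal ((r powr (-\<beta>)) powr p) * indicator (ball x (2 * r)) y \<partial>M)"
    using assms by (intro nn_integral_cong) (auto simp: g_def indicator_def ennreal_powr_ennreal)
  also have "\<dots> = ennreal ((r powr (-\<beta>)) powr p) * emeasure M (ball x (2 * r))"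
    by (simp add: nn_integral_cmult_indicator)
  also have "\<dots> \<le> ennreal ((r powr (-\<beta>)) powr p) * ennreal (K * (2 * r) powr Q)"
    using measure_ball_le[of "2 * r" x] assms by (intro mult_left_mono) (auto simp: emeasure_ball ennreal_leI)
  also have "\<dots> = ennreal ((r powr (-\<beta>)) powr p * (K * (2 * r) powr Q))"
    using K_ge_1 by (simp flip: ennreal_mult)
  also have "(r powr (-\<beta>)) powr p * (K * (2 * r) powr Q) = K * 2 powr Q * r powr (Q - \<beta> * p)"
  proof -
    have "(r powr (-\<beta>)) powr p * r powr Q = r powr (Q - \<beta> * p)"
      by (simp add: powr_powr flip: powr_add)
    then show ?thesis by (simp add: powr_mult mult_ac)
  qed
  finally show ?thesis .
qed

section \<open>Hajlasz capacity is dominated by Riesz capacity\<close>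

text \<open>Radius 4 s leaves room for a whole ball of radius 2 s about any point within 2 s of the
  centre. \<open>prod_decode\<close> enumerates the pairs of a centre and a scale.\<close>

lemma dyadic_covering_balls:
  assumes "0 < \<rho>"
  shows "\<exists>(c :: nat \<Rightarrow> 'a) q. (\<forall>k. 0 < q k) \<and> (\<forall>i y. \<exists>k. q k = 4 * (\<rho> / 2 ^ i) \<and> dist (c k) y < 2 * (\<rho> / 2 ^ i))"
proof -
  obtain D :: "nat \<Rightarrow> 'a" where D: "\<And>y e. 0 < e \<Longrightarrow> \<exists>i. dist (D i) y < e" using countable_dense by blast
  define c where "c k = D (fst (prod_decode k))" for k
  define q where "q k = 4 * (\<rho> / 2 ^ snd (prod_decode k))" for k
  have "\<exists>k. q k = 4 * (\<rho> / 2 ^ i) \<and> dist (c k) y < 2 * (\<rho> / 2 ^ i)" for i y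
  proof -
    have "0 < 2 * (\<rho> / 2 ^ i)" using assms by simp
    then obtain j where "dist (D j) y < 2 * (\<rho> / 2 ^ i)" using D by blast
    then show ?thesis by (intro exI[of _ "prod_encode (j, i)"]) (simp add: c_def q_def)
  qed
  moreover have "0 < q k" for k using assms by (simp add: q_def)
  ultimately show ?thesis by blast
qed

text \<open>With this \<epsilon> the Young term K \<epsilon> contributes 1 / (4 L) to the far
  scales, and the energy bound makes the other term contribute as much. At least 1 / (2 L) is left
  for the small scales; asking for more than 1 / (4 L) leaves the slack that lets a partial sum
  suffice.\<close>

lemma smooth_potential_large:
  assumes f: "f \<in> borel_measurable M" and "1 < p" "0 < \<beta>" "\<beta> * p < Q" "0 < r"
    and "1 \<le> riesz_potential M \<beta> f y" "dist x y \<le> r"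
    and L: "L = K * 2 powr (Q - \<beta>)" and \<epsilon>: "\<epsilon> = (1 - 2 powr (\<beta> - Q / p)) / (4 * K * L)"
    and N: "(\<integral>\<^sup>+w. ennreal_powr (f w) p \<partial>M)
      \<le> ennreal (\<epsilon> powr (p - 1) * (1 - 2 powr (\<beta> - Q / p)) / (4 * L) * (r / 8) powr (Q - \<beta> * p))"
  shows "\<exists>n. ennreal (1 / (4 * L)) < smooth_potential \<beta> (r / 8) n (\<lambda>w. f w * indicator (ball x (3 * r / 2)) w) y"
proof -
  note [measurable] = f
  define \<rho> where "\<rho> = r / 8"
  define \<eta> where "\<eta> = 1 - 2 powr (\<beta> - Q / p)"
  define f' where "f' w = f w * indicator (ball x (3 * r / 2)) w" for w
  have [measurable]: "f' \<in> borel_measurable M" unfolding f'_def by measurable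
  have \<rho>: "0 < \<rho>" using assms by (simp add: \<rho>_def)
  have \<eta>: "0 < \<eta>" using assms by (simp add: \<eta>_def powr_less_one field_simps)
  have L0: "0 < L" using K_ge_1 by (simp add: L)
  have \<epsilon>0: "0 < \<epsilon>" using \<eta> L0 K_ge_1 unfolding \<epsilon> \<eta>_def by (intro divide_pos_pos mult_pos_pos) auto
  have "\<beta> * 1 < \<beta> * p" using assms by (intro mult_strict_left_mono) auto
  then have \<beta>Q: "\<beta> < Q" using assms(4) by linarith
  define far where "far = (\<Sum>i. ennreal ((\<rho> * 2 ^ Suc i) powr (\<beta> - Q)) * (\<integral>\<^sup>+w. f w * indicator (ball y (\<rho> * 2 ^ Suc i)) w \<partial>M))"
  define near where "near = (\<Sum>i. ennreal ((\<rho> / 2 ^ i) powr (\<beta> - Q)) * bump_integral f' (\<rho> / 2 ^ i) y)"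
  let ?N = "\<integral>\<^sup>+w. ennreal_powr (f w) p \<partial>M"
  have "far \<le> ennreal (1 / \<eta>) * (ennreal (K * \<epsilon>) + ennreal (\<epsilon> powr (1 - p) * \<rho> powr (\<beta> * p - Q)) * ?N)"
    unfolding far_def \<eta>_def using assms \<rho> \<epsilon>0 by (intro far_scales_le) auto
  also have "\<dots> \<le> ennreal (1 / \<eta>) * (ennreal (K * \<epsilon>) + ennreal (\<epsilon> powr (1 - p) * \<rho> powr (\<beta> * p - Q)) *
      ennreal (\<epsilon> powr (p - 1) * \<eta> / (4 * L) * \<rho> powr (Q - \<beta> * p)))"
    using N unfolding \<rho>_def \<eta>_def by (intro mult_left_mono add_left_mono) auto
  also have "\<dots> = ennreal (1 / \<eta> * (K * \<epsilon> + (\<epsilon> powr (1 - p) * \<rho> powr (\<beta> * p - Q)) * (\<epsilon> powr (p - 1) * \<eta> / (4 * L) * \<rho> powr (Q - \<beta> * p))))"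
    using \<eta> \<epsilon>0 K_ge_1 L0 by (intro ennreal_affine) auto
  also have "(\<epsilon> powr (1 - p) * \<rho> powr (\<beta> * p - Q)) * (\<epsilon> powr (p - 1) * \<eta> / (4 * L) * \<rho> powr (Q - \<beta> * p))
      = (\<epsilon> powr (1 - p) * \<epsilon> powr (p - 1)) * (\<rho> powr (\<beta> * p - Q) * \<rho> powr (Q - \<beta> * p)) * (\<eta> / (4 * L))"
    by simp
  also have "\<dots> = \<eta> / (4 * L)" using \<epsilon>0 \<rho> by (simp flip: powr_add)
  also have "1 / \<eta> * (K * \<epsilon> + \<eta> / (4 * L)) = 1 / (2 * L)"
    using \<eta> L0 K_ge_1 unfolding \<epsilon> \<eta>_def[symmetric] by (simp add: field_simps)
  finally have far: "far \<le> ennreal (1 / (2 * L))" .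
  \<comment> \<open>Points within r / 8 of y are within 9 r / 8 of x, hence inside the cutoff
    ball.\<close>
  have "f' w = f w" if "dist y w < \<rho>" for w
    using that assms dist_triangle[of x w y] by (simp add: f'_def \<rho>_def)
  then have "riesz_potential M \<beta> f y \<le> ennreal L * (near + far)"
    unfolding near_def far_def L using assms \<rho> \<beta>Q by (intro riesz_potential_le_near_far) auto
  then have "1 \<le> ennreal L * (near + far)" using assms(6) by (rule order_trans[rotated])
  also have "\<dots> \<le> ennreal L * (near + ennreal (1 / (2 * L)))" using far by (intro mult_left_mono add_left_mono) auto
  finally have ge: "1 \<le> ennreal L * (near + ennreal (1 / (2 * L)))" .
  have "ennreal (1 / (4 * L)) < near"
  proof (rule ccontr)
    assume "\<not> ?thesis"
    then have "ennreal L * (near + ennreal (1 / (2 * L))) \<le> ennreal L * (ennreal (1 / (4 * L)) + ennreal (1 / (2 * L)))"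
      by (intro mult_left_mono add_right_mono) auto
    also have "\<dots> = ennreal (3 / 4)" using L0 by (simp add: field_simps flip: ennreal_mult ennreal_plus)
    also have "\<dots> < 1" by (simp add: ennreal_less_one_iff)
    finally show False using ge by simp
  qed
  then show ?thesis
    unfolding near_def suminf_eq_SUP less_SUP_iff smooth_potential_def f'_def \<rho>_def by blast
qed

lemma hajlasz_capacity_le_smooth_potential:
  assumes f: "f \<in> borel_measurable M" and \<beta>: "0 < \<beta>" "\<beta> < 1" and p: "1 < p" and r: "0 < r"
    and F: "F \<subseteq> cball x r" and fin: "(\<integral>\<^sup>+w. f w * indicator (ball x (3 * r / 2)) w \<partial>M) < \<infinity>" and "closed F" and "0 < a"
    and large: "\<And>y. y \<in> F \<Longrightarrow> \<exists>n. ennreal a < smooth_potential \<beta> (r / 8) n (\<lambda>w. f w * indicator (ball x (3 * r / 2)) w) y"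
  shows "hajlasz_capacity M \<beta> p F (ball x (2 * r)) \<le>
    ennreal ((1 / a * (K * 4 powr Q * (1 / (1 - 2 powr (-\<beta>)) + 1 / (1 - 2 powr (\<beta> - 1))))) powr p
      * (2 * K\<^sup>2 * (p / (p - 1) * 2 powr (p - 1)))) * (\<integral>\<^sup>+w. ennreal_powr (f w) p \<partial>M)"
proof -
  note [measurable] = f
  define f' where "f' w = f w * indicator (ball x (3 * r / 2)) w" for w
  have [measurable]: "f' \<in> borel_measurable M" unfolding f'_def by measurable
  define \<rho> where "\<rho> = r / 8"
  have \<rho>: "0 < \<rho>" using r by (simp add: \<rho>_def)
  define S where "S = K * 4 powr Q * (1 / (1 - 2 powr (-\<beta>)) + 1 / (1 - 2 powr (\<beta> - 1)))"
  have "2 powr (-\<beta>) < (1::real)" "2 powr (\<beta> - 1) < (1::real)" using \<beta> by (auto simp: powr_less_one)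
  then have S: "0 < S" using K_ge_1 unfolding S_def by (intro mult_pos_pos add_pos_pos divide_pos_pos) auto
  obtain N' where N': "(\<integral>\<^sup>+w. f' w \<partial>M) = ennreal N'" "0 \<le> N'"
    using fin unfolding f'_def by (cases "\<integral>\<^sup>+w. f w * indicator (ball x (3 * r / 2)) w \<partial>M") auto
  define V where "V n = smooth_potential \<beta> \<rho> n f'" for n
  define v where "v n y = enn2real (V n y)" for n y
  have Vv: "V n y = ennreal (v n y)" and v0: "0 \<le> v n y" for n y
  proof -
    obtain B where "V n y \<le> ennreal B"
      using smooth_potential_finite(1)[OF _ \<rho> N', of \<beta> n] unfolding V_def by auto
    then have "V n y < top" by (rule le_less_trans) simp
    then show "V n y = ennreal (v n y)" by (simp add: v_def)
  qed (simp add: v_def)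
  have v_bdd: "\<exists>B. \<forall>y. v n y \<le> B" for n
  proof -
    obtain B where "\<And>y. V n y \<le> ennreal B"
      using smooth_potential_finite(1)[OF _ \<rho> N', of \<beta> n] unfolding V_def by auto
    then have "ennreal (v n y) \<le> ennreal (max 0 B)" for y
      unfolding Vv[symmetric] by (rule order_trans) (simp add: ennreal_leI)
    then have "v n y \<le> max 0 B" for y by (simp only: ennreal_le_iff max.cobounded1)
    then show ?thesis by blast
  qed
  have v_Lip: "\<exists>L. \<forall>y z. \<bar>v n y - v n z\<bar> \<le> L * dist y z" for n
  proof -
    obtain L where L: "0 \<le> L" "\<And>y z. V n y \<le> V n z + ennreal (L * dist y z)"
      using smooth_potential_finite(2)[OF _ \<rho> N', of \<beta> n] unfolding V_def by auto
    have le: "v n y \<le> v n z + L * dist y z" for y z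
      using L(2)[of y z] L(1) v0[of n z] by (simp add: Vv flip: ennreal_plus)
    then have "\<bar>v n y - v n z\<bar> \<le> L * dist y z" for y z
      using le[of y z] le[of z y] unfolding dist_commute[of z y] by linarith
    then show ?thesis by blast
  qed
  have v_cont: "continuous_on UNIV (v n)" for n
  proof -
    obtain L where L: "\<And>y z. \<bar>v n y - v n z\<bar> \<le> L * dist y z" using v_Lip by blast
    have "(max L 0)-lipschitz_on UNIV (v n)"
    proof (rule lipschitz_onI)
      show "dist (v n y) (v n z) \<le> max L 0 * dist y z" for y z
        using L[of y z] mult_right_mono[of L "max L 0" "dist y z"] by (simp add: dist_real_def)
    qed simp
    then show ?thesis by (rule lipschitz_on_continuous_on)
  qed
  have v_mono: "v m y \<le> v n y" if "m \<le> n" for m n y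
  proof -
    have "V m y \<le> V n y" unfolding V_def smooth_potential_def using that by (intro sum_mono2) auto
    then show ?thesis using v0 by (simp add: Vv)
  qed
  \<comment> \<open>The sets where \<open>v n\<close> exceeds a are open and increase with n, so a
    finite subcover amounts to one n for all of F.\<close>
  have "compact F"
    using \<open>closed F\<close> F compact_closed_ball_subset[of F x "2 * r"] r by force
  moreover have "open {y. a < v n y}" for n
    by (intro open_Collect_less continuous_intros v_cont)
  moreover have "F \<subseteq> (\<Union>n. {y. a < v n y})"
    using large \<open>0 < a\<close> by (fastforce simp: V_def[symmetric] f'_def[symmetric] \<rho>_def[symmetric] Vv ennreal_less_iff)
  ultimately obtain I where I: "finite I" "F \<subseteq> (\<Union>n\<in>I. {y. a < v n y})"
    using compactE_image[of F UNIV "\<lambda>n. {y. a < v n y}"] by auto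
  \<comment> \<open>Inserting 0 keeps the maximum meaningful when I is empty, as may happen for
    empty F.\<close>
  define n where "n = Max (insert 0 I)"
  have v_ge: "a < v n y" if y: "y \<in> F" for y
  proof -
    obtain m where "m \<in> I" "a < v m y" using I y by auto
    then show ?thesis using v_mono[of m n y] I(1) by (simp add: n_def less_le_trans)
  qed
  obtain c :: "nat \<Rightarrow> 'a" and q where q: "\<And>k. 0 < q k"
    and cover: "\<And>i y. \<exists>k. q k = 4 * (\<rho> / 2 ^ i) \<and> dist (c k) y < 2 * (\<rho> / 2 ^ i)"
    using dyadic_covering_balls[OF \<rho>] by blast
  define u where "u y = 1 / a * v n y" for y
  define g where "g y = ennreal (1 / a * S) * maximal c q f' y" for y
  have "u \<in> Lip \<beta>"
  proof -
    obtain B where B: "\<And>y. v n y \<le> B" using v_bdd by blast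
    obtain L where L: "\<And>y z. \<bar>v n y - v n z\<bar> \<le> L * dist y z" using v_Lip by blast
    show ?thesis
    proof (rule bounded_Lipschitz_in_Lip)
      show "\<bar>u y\<bar> \<le> B / a" for y
        using B[of y] v0[of n y] \<open>0 < a\<close> by (simp add: u_def divide_right_mono)
      show "\<bar>u y - u z\<bar> \<le> L / a * dist y z" for y z
      proof -
        have "\<bar>u y - u z\<bar> = \<bar>v n y - v n z\<bar> / a"
          using \<open>0 < a\<close> by (simp add: u_def flip: diff_divide_distrib)
        then show ?thesis using L[of y z] \<open>0 < a\<close> by (simp add: divide_right_mono)
      qed
    qed (use \<beta> in auto)
  qed
  moreover have "1 \<le> u y" if "y \<in> F" for y
    using v_ge[OF that] \<open>0 < a\<close> by (simp add: u_def)
  moreover have "u y = 0" if y: "y \<notin> ball x (2 * r)" for y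
  proof -
    have "bump_integral f' (\<rho> / 2 ^ i) y = 0" for i
    proof -
      have "f' w * ennreal (bump (dist y w / (\<rho> / 2 ^ i))) = 0" for w
      proof (cases "w \<in> ball x (3 * r / 2)")
        case True
        \<comment> \<open>The bumps reach no farther than 2 \<rho> = r / 4, while y is more than r /
          2 away from every point of the cutoff ball.\<close>
        have "2 * (\<rho> / 2 ^ i) \<le> 2 * \<rho>" using \<rho> by (simp add: field_simps)
        also have "\<dots> \<le> dist y w"
          using True y r dist_triangle[of x y w] by (simp add: \<rho>_def dist_commute)
        finally have "bump (dist y w / (\<rho> / 2 ^ i)) = 0" using \<rho> by (intro bump_eq_0) (simp add: field_simps)
        then show ?thesis by (simp only: ennreal_0 mult_zero_right)
      qed (simp add: f'_def)
      then show ?thesis unfolding bump_integral_def by (simp only: nn_integral_const) simp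
    qed
    then show ?thesis by (simp add: u_def v_def V_def smooth_potential_def)
  qed
  moreover have "g \<in> hajlasz_gradients M \<beta> u"
    unfolding hajlasz_gradients_def
  proof (intro CollectI conjI bexI ballI)
    show "g \<in> borel_measurable M" unfolding g_def by measurable
    show "ennreal \<bar>u y - u z\<bar> \<le> ennreal (dist y z powr \<beta>) * (g y + g z)" for y z
    proof -
      let ?E = "ennreal (S * dist y z powr \<beta>) * (maximal c q f' y + maximal c q f' z)"
      have V: "V n y \<le> V n z + ?E" "V n z \<le> V n y + ?E"
        using smooth_potential_diff_maximal[where c = c and q = q and f = f' and y = y and z = z and n = n, OF _ \<rho> \<beta> q cover]
          smooth_potential_diff_maximal[where c = c and q = q and f = f' and y = z and z = y and n = n, OF _ \<rho> \<beta> q cover]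
        by (simp_all add: V_def S_def dist_commute add.commute)
      \<comment> \<open>Subtraction is safe because \<open>V n\<close> is finite; the two orders
        together bound the absolute value.\<close>
      have "ennreal (v n y - v n z) \<le> ?E" "ennreal (v n z - v n y) \<le> ?E"
        using V v0 by (auto simp: Vv ennreal_minus[symmetric] ennreal_minus_le_iff)
      then have "ennreal \<bar>v n y - v n z\<bar> \<le> ?E" by (simp add: abs_if)
      then have "ennreal (1 / a) * ennreal \<bar>v n y - v n z\<bar> \<le> ennreal (1 / a) * ?E" by (rule mult_left_mono) simp
      moreover have "ennreal \<bar>u y - u z\<bar> = ennreal (1 / a) * ennreal \<bar>v n y - v n z\<bar>"
      proof -
        have "\<bar>u y - u z\<bar> = 1 / a * \<bar>v n y - v n z\<bar>"
          using \<open>0 < a\<close> by (simp add: u_def flip: diff_divide_distrib)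
        then show ?thesis using \<open>0 < a\<close> by (simp add: ennreal_mult del: times_divide_eq_left)
      qed
      moreover have "ennreal (1 / a) * ?E = ennreal (dist y z powr \<beta>) * (g y + g z)"
      proof -
        have "ennreal (S * dist y z powr \<beta>) = ennreal S * ennreal (dist y z powr \<beta>)"
          "ennreal (1 / a * S) = ennreal (1 / a) * ennreal S" using S \<open>0 < a\<close> by (intro ennreal_mult; simp)+
        then show ?thesis unfolding g_def by (simp only: distrib_left mult_ac)
      qed
      ultimately show ?thesis by simp
    qed
  qed auto
  ultimately have "hajlasz_capacity M \<beta> p F (ball x (2 * r)) \<le> (\<integral>\<^sup>+y. ennreal_powr (g y) p \<partial>M)"
    unfolding hajlasz_capacity_def by (intro INF_lower2[of u] INF_lower) auto
  also have "\<dots> = ennreal ((1 / a * S) powr p) * (\<integral>\<^sup>+y. ennreal_powr (maximal c q f' y) p \<partial>M)"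
  proof -
    have "ennreal_powr (g y) p = ennreal ((1 / a * S) powr p) * ennreal_powr (maximal c q f' y) p" for y
      unfolding g_def using S \<open>0 < a\<close> p by (intro ennreal_powr_mult mult_pos_pos) auto
    then show ?thesis by (simp add: nn_integral_cmult)
  qed
  also have "\<dots> \<le> ennreal ((1 / a * S) powr p) * (ennreal (2 * K\<^sup>2 * (p / (p - 1) * 2 powr (p - 1))) * (\<integral>\<^sup>+y. ennreal_powr (f y) p \<partial>M))"
  proof (rule mult_left_mono)
    have "(\<integral>\<^sup>+y. ennreal_powr (maximal c q f' y) p \<partial>M) \<le>
      ennreal (2 * K\<^sup>2 * (p / (p - 1) * 2 powr (p - 1))) * (\<integral>\<^sup>+y. ennreal_powr (f' y) p \<partial>M)"
      using p q by (intro maximal_Lp) auto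
    also have "\<dots> \<le> ennreal (2 * K\<^sup>2 * (p / (p - 1) * 2 powr (p - 1))) * (\<integral>\<^sup>+y. ennreal_powr (f y) p \<partial>M)"
      using p by (intro mult_left_mono nn_integral_mono ennreal_powr_mono) (auto simp: f'_def indicator_def)
    finally show "(\<integral>\<^sup>+y. ennreal_powr (maximal c q f' y) p \<partial>M) \<le>
      ennreal (2 * K\<^sup>2 * (p / (p - 1) * 2 powr (p - 1))) * (\<integral>\<^sup>+y. ennreal_powr (f y) p \<partial>M)" .
  qed simp
  also have "\<dots> = ennreal ((1 / a * S) powr p * (2 * K\<^sup>2 * (p / (p - 1) * 2 powr (p - 1)))) * (\<integral>\<^sup>+y. ennreal_powr (f y) p \<partial>M)"
    using p by (subst ennreal_mult) (auto simp: mult.assoc)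
  finally show ?thesis unfolding S_def .
qed

lemma hajlasz_capacity_le_riesz_capacity:
  assumes "1 < p" "0 < \<beta>" "\<beta> < 1" "\<beta> * p < Q"
  shows "\<exists>C>0. \<forall>F x r. 0 < r \<longrightarrow> closed F \<longrightarrow> F \<subseteq> cball x r \<longrightarrow>
    hajlasz_capacity M \<beta> p F (ball x (2 * r)) \<le> ennreal C * riesz_capacity M \<beta> p F"
proof -
  define L where "L = K * 2 powr (Q - \<beta>)"
  define \<epsilon> where "\<epsilon> = (1 - 2 powr (\<beta> - Q / p)) / (4 * K * L)"
  define c0 where "c0 = \<epsilon> powr (p - 1) * (1 - 2 powr (\<beta> - Q / p)) / (4 * L)"
  define C1 where "C1 = (1 / (1 / (4 * L)) * (K * 4 powr Q * (1 / (1 - 2 powr (-\<beta>)) + 1 / (1 - 2 powr (\<beta> - 1))))) powr p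
      * (2 * K\<^sup>2 * (p / (p - 1) * 2 powr (p - 1)))"
  \<comment> \<open>Chosen so that C2 times the energy threshold is the energy bound of the cutoff
    function; the power of 8 undoes the radius r / 8.\<close>
  define C2 where "C2 = K * 2 powr Q * 8 powr (Q - \<beta> * p) / c0"
  have \<eta>: "0 < 1 - 2 powr (\<beta> - Q / p)" using assms by (simp add: powr_less_one field_simps)
  have L: "0 < L" using K_ge_1 by (simp add: L_def)
  have \<epsilon>: "0 < \<epsilon>" using \<eta> L K_ge_1 unfolding \<epsilon>_def by (intro divide_pos_pos mult_pos_pos) auto
  have c0: "0 < c0" using \<eta> L \<epsilon> unfolding c0_def by (intro divide_pos_pos mult_pos_pos) auto
  have C2: "0 < C2" using c0 K_ge_1 unfolding C2_def by (intro divide_pos_pos mult_pos_pos) auto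
  have C1: "0 \<le> C1" using assms unfolding C1_def by (intro mult_nonneg_nonneg) auto
  have C: "0 < max C1 C2" using C2 by simp
  have "hajlasz_capacity M \<beta> p F (ball x (2 * r)) \<le> ennreal (max C1 C2) * riesz_capacity M \<beta> p F"
    if H: "0 < r" "closed F" "F \<subseteq> cball x r" for F x r
  proof -
    let ?cap = "hajlasz_capacity M \<beta> p F (ball x (2 * r))"
    have main: "?cap \<le> ennreal (max C1 C2) * (\<integral>\<^sup>+w. ennreal_powr (f w) p \<partial>M)"
      if f[measurable]: "f \<in> borel_measurable M" and f1: "\<And>y. y \<in> F \<Longrightarrow> 1 \<le> riesz_potential M \<beta> f y" for f
    proof (cases "(\<integral>\<^sup>+w. ennreal_powr (f w) p \<partial>M) \<le> ennreal (c0 * (r / 8) powr (Q - \<beta> * p))")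
      case True
      let ?N = "\<integral>\<^sup>+w. ennreal_powr (f w) p \<partial>M"
      \<comment> \<open>Young's inequality with parameter 1: finite energy makes f integrable over
        the cutoff ball.\<close>
      have "(\<integral>\<^sup>+w. f w * indicator (ball x (3 * r / 2)) w \<partial>M)
          \<le> ennreal (1 * (K * (3 * r / 2) powr Q)) + ennreal (1 powr (1 - p)) * ?N"
        using assms H by (intro ball_integral_young) auto
      also have "\<dots> < \<infinity>" using True by (simp add: less_top[symmetric] top_unique) (metis ennreal_neq_top neq_top_trans)
      finally have fin: "(\<integral>\<^sup>+w. f w * indicator (ball x (3 * r / 2)) w \<partial>M) < \<infinity>" .
      have "\<exists>n. ennreal (1 / (4 * L)) < smooth_potential \<beta> (r / 8) n (\<lambda>w. f w * indicator (ball x (3 * r / 2)) w) y"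
        if "y \<in> F" for y
        using assms H that True
        by (intro smooth_potential_large[OF f _ _ _ _ f1[OF that] _ L_def \<epsilon>_def]) (auto simp: c0_def)
      then have "?cap \<le> ennreal C1 * ?N"
        unfolding C1_def using assms H fin L
        by (intro hajlasz_capacity_le_smooth_potential) auto
      also have "\<dots> \<le> ennreal (max C1 C2) * ?N" by (intro mult_right_mono ennreal_leI) auto
      finally show ?thesis .
    next
      case False
      have "?cap \<le> ennreal (K * 2 powr Q * r powr (Q - \<beta> * p))"
        using assms H by (intro hajlasz_capacity_le_cutoff) auto
      also have "K * 2 powr Q * r powr (Q - \<beta> * p) = C2 * (c0 * (r / 8) powr (Q - \<beta> * p))"
        using c0 H by (simp add: C2_def powr_divide)
      also have "ennreal \<dots> = ennreal C2 * ennreal (c0 * (r / 8) powr (Q - \<beta> * p))"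
        using C2 c0 by (intro ennreal_mult) auto
      also have "\<dots> \<le> ennreal (max C1 C2) * (\<integral>\<^sup>+w. ennreal_powr (f w) p \<partial>M)"
        using False by (intro mult_mono ennreal_leI) auto
      finally show ?thesis .
    qed
    have "ennreal (inverse (max C1 C2)) * ?cap \<le> riesz_capacity M \<beta> p F"
      unfolding riesz_capacity_def
    proof (intro INF_greatest)
      fix f assume "f \<in> {f \<in> borel_measurable M. \<forall>x\<in>F. 1 \<le> riesz_potential M \<beta> f x}"
      then have "ennreal (inverse (max C1 C2)) * ?cap
        \<le> ennreal (inverse (max C1 C2)) * (ennreal (max C1 C2) * (\<integral>\<^sup>+w. ennreal_powr (f w) p \<partial>M))"
        by (intro mult_left_mono main) auto
      also have "\<dots> = (\<integral>\<^sup>+w. ennreal_powr (f w) p \<partial>M)"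
        by (rule ennreal_inverse_cancel(1)[OF C])
      finally show "ennreal (inverse (max C1 C2)) * ?cap \<le> (\<integral>\<^sup>+w. ennreal_powr (f w) p \<partial>M)" .
    qed
    then have "ennreal (max C1 C2) * (ennreal (inverse (max C1 C2)) * ?cap) \<le> ennreal (max C1 C2) * riesz_capacity M \<beta> p F"
      by (intro mult_left_mono) auto
    then show ?thesis by (simp only: ennreal_inverse_cancel(2)[OF C])
  qed
  then show ?thesis using C by blast
qed

end

section \<open>Ahlfors regular spaces\<close>

lemma ediameter_gtD:
  assumes "ennreal d < ediameter (UNIV :: 'a::metric_space set)" "0 \<le> d"
  shows "\<exists>a b :: 'a. d < dist a b"
  using assms by (auto simp: ediameter_def less_SUP_iff ennreal_less_iff)

lemma dist_le_ediameter:
  fixes a b :: "'a::metric_space"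
  shows "ennreal (dist a b) \<le> ediameter (UNIV :: 'a set)"
  unfolding ediameter_def by (intro SUP_upper2[of a] SUP_upper2[of b]) auto

text \<open>The distances from x form a connected set of reals containing 0 and
  \<open>dist x a\<close>.\<close>

lemma connected_exists_dist_eq:
  fixes x a :: "'a::metric_space"
  assumes "connected (UNIV :: 'a set)" "0 \<le> t" "t \<le> dist x a"
  shows "\<exists>z. dist x z = t"
proof -
  have "connected (range (dist x))"
    using assms(1) by (intro connected_continuous_image continuous_intros)
  moreover have "0 \<in> range (dist x)" "dist x a \<in> range (dist x)" by (auto intro: image_eqI[of _ _ x])
  ultimately have "t \<in> range (dist x)" using assms(2,3) connectedD_interval by blast
  then show ?thesis by auto
qed

lemma ahlfors_regular_imp_regular_space:
  fixes M :: "'a::metric_space measure"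
  assumes "0 < Q" "metric_measure_space M" "doubling M" "complete (UNIV :: 'a set)" "ahlfors_regular Q M"
  shows "\<exists>K. regular_space M Q K"
proof -
  interpret metric_measure_space M by fact
  obtain c where c: "1 < c" "\<And>x r. 0 < r \<Longrightarrow> emeasure M (ball x (2 * r)) \<le> ennreal c * emeasure M (ball x r)"
    using assms(3) unfolding doubling_def by blast
  obtain k where k: "1 \<le> k"
    and lo: "\<And>x r. 0 < r \<Longrightarrow> ennreal r < ediameter (UNIV :: 'a set) \<Longrightarrow> ennreal (inverse k * r powr Q) \<le> emeasure M (ball x r)"
    and up: "\<And>x r. 0 < r \<Longrightarrow> ennreal r < ediameter (UNIV :: 'a set) \<Longrightarrow> emeasure M (ball x r) \<le> ennreal (k * r powr Q)"
    using assms(5) unfolding ahlfors_regular_def by blast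
  have em: "emeasure M (ball x r) = ennreal (measure M (ball x r))" for x :: 'a and r
  proof (cases "0 < r")
    case True
    then show ?thesis using ball_finite[of r x] by (intro emeasure_eq_ennreal_measure) auto
  qed (simp add: ball_empty)
  \<comment> \<open>The factor c pays for radii beyond the diameter in the upper bound, 2^Q for
    halving the radius in the lower bound.\<close>
  define K where "K = c * k * 2 powr Q"
  have two: "1 \<le> 2 powr Q" using assms(1) by (intro ge_one_powr_ge_zero) auto
  have "1 * 1 \<le> c * k" using c k by (intro mult_mono) auto
  then have ck: "1 \<le> c * k" by simp
  have cK: "c * k \<le> K" unfolding K_def using ck two mult_left_mono[of 1 "2 powr Q" "c * k"] by simp
  have kK: "k * 2 powr Q \<le> K" unfolding K_def using c k two by (simp add: mult_right_mono)
  have "c * 1 \<le> c * k" using c k by (intro mult_left_mono) auto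
  then have c_le: "c \<le> K" using cK by simp
  have "1 * k \<le> c * k" using c k by (intro mult_right_mono) auto
  then have k_le: "k \<le> K" using cK by simp
  show ?thesis
  proof (intro exI[of _ K], unfold_locales)
    show "0 < Q" "complete (UNIV :: 'a set)" by fact+
    show "1 \<le> K" using ck cK by simp
    show "measure M (ball x (2 * r)) \<le> K * measure M (ball x r)" if "0 < r" for x :: 'a and r
    proof -
      have "ennreal (measure M (ball x (2 * r))) \<le> ennreal (c * measure M (ball x r))"
        using c(2)[OF that, of x] c(1) by (simp add: em ennreal_mult)
      then have "measure M (ball x (2 * r)) \<le> c * measure M (ball x r)" using c(1) by (subst (asm) ennreal_le_iff) auto
      also have "\<dots> \<le> K * measure M (ball x r)" using c_le by (intro mult_right_mono) auto
      finally show ?thesis .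
    qed
    have up': "measure M (ball x r) \<le> k * r powr Q" if "0 < r" "ennreal r < ediameter (UNIV :: 'a set)" for x :: 'a and r
      using up[OF that, of x] k by (simp add: em)
    text \<open>Beyond the diameter, shrink the radius: a ball of radius between half the diameter and the
      diameter has a double that is the whole space.\<close>
    show "measure M (ball x r) \<le> K * r powr Q" if r: "0 < r" for x :: 'a and r
    proof (cases "ennreal r < ediameter (UNIV :: 'a set)")
      case True
      have "measure M (ball x r) \<le> k * r powr Q" by (rule up'[OF r True])
      also have "\<dots> \<le> K * r powr Q" using k_le by (intro mult_right_mono) auto
      finally show ?thesis .
    next
      case False
      obtain \<delta> where \<delta>: "ediameter (UNIV :: 'a set) = ennreal \<delta>" "0 \<le> \<delta>" "\<delta> \<le> r"
        using False r by (cases "ediameter (UNIV :: 'a set)") (auto simp: not_less)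
      obtain a b :: 'a where "a \<noteq> b" using two_points by blast
      then have "0 < \<delta>" using dist_le_ediameter[of a b] \<delta> by (simp add: ennreal_le_iff) (meson less_le_trans zero_less_dist_iff)
      have "ball x r \<subseteq> ball x (2 * (3 / 4 * \<delta>))"
      proof
        fix w
        have "dist x w \<le> \<delta>" using dist_le_ediameter[of x w] \<delta> by simp
        then show "w \<in> ball x (2 * (3 / 4 * \<delta>))" using \<open>0 < \<delta>\<close> by simp
      qed
      then have "emeasure M (ball x r) \<le> emeasure M (ball x (2 * (3 / 4 * \<delta>)))"
        using borel_sets by (intro emeasure_mono) auto
      also have "\<dots> \<le> ennreal c * emeasure M (ball x (3 / 4 * \<delta>))" using \<open>0 < \<delta>\<close> by (intro c(2)) simp
      finally have "measure M (ball x r) \<le> c * measure M (ball x (3 / 4 * \<delta>))"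
        using c(1) by (simp add: em flip: ennreal_mult)
      also have "\<dots> \<le> c * (k * (3 / 4 * \<delta>) powr Q)"
        using c(1) \<open>0 < \<delta>\<close> \<delta> by (intro mult_left_mono up') (auto simp: ennreal_less_iff)
      also have "\<dots> \<le> c * (k * r powr Q)"
        using c(1) k \<open>0 < \<delta>\<close> \<delta> assms(1) by (intro mult_left_mono powr_mono2) auto
      also have "\<dots> = c * k * r powr Q" by simp
      also have "\<dots> \<le> K * r powr Q" using cK by (intro mult_right_mono) auto
      finally show ?thesis .
    qed
    show "r powr Q \<le> K * measure M (ball x r)" if r: "0 < r" "r \<le> dist a b" for x a b :: 'a and r
    proof -
      \<comment> \<open>The radius r may equal the diameter, while regularity is assumed strictly
        below it; halving restores strictness.\<close>
      have "ennreal (r / 2) < ennreal (dist a b)" using r by (intro ennreal_lessI) auto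
      also have "\<dots> \<le> ediameter (UNIV :: 'a set)" by (rule dist_le_ediameter)
      finally have "ennreal (inverse k * (r / 2) powr Q) \<le> emeasure M (ball x (r / 2))"
        using r by (intro lo) auto
      also have "\<dots> \<le> emeasure M (ball x r)" using r borel_sets by (intro emeasure_mono) auto
      finally have "inverse k * (r / 2) powr Q \<le> measure M (ball x r)" by (simp add: em)
      then have "r powr Q \<le> k * 2 powr Q * measure M (ball x r)"
        using k r by (simp add: powr_divide field_simps)
      also have "\<dots> \<le> K * measure M (ball x r)" using kK by (intro mult_right_mono) auto
      finally show ?thesis .
    qed
  qed
qed

theorem theorem1p1:
  fixes M :: "'a::metric_space measure" and p \<beta> Q :: real
  assumes "1 < p" and "0 < \<beta>" and "\<beta> < 1" and "0 < Q" and "Q > \<beta> * p"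
    and "metric_measure_space M" and "doubling M"
    and "complete (UNIV :: 'a set)" and "connected (UNIV :: 'a set)"
    and "ahlfors_regular Q M"
  shows "\<exists>C::real. C > 0 \<and>
    (\<forall>(E :: 'a set) x r.
      closed E \<and> x \<in> E \<and> 0 < r \<and> ennreal r < (1 / 8) * ediameter (UNIV :: 'a set) \<longrightarrow>
      ennreal (inverse C) * riesz_capacity M \<beta> p (E \<inter> closure (ball x r))
        \<le> hajlasz_capacity M \<beta> p (E \<inter> closure (ball x r)) (ball x (2 * r)) \<and>
      hajlasz_capacity M \<beta> p (E \<inter> closure (ball x r)) (ball x (2 * r))
        \<le> ennreal C * riesz_capacity M \<beta> p (E \<inter> closure (ball x r)))"
proof -
  obtain K where "regular_space M Q K"
    using ahlfors_regular_imp_regular_space[OF assms(4,6,7,8,10)] by blast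
  then interpret regular_space M Q K .
  have "\<beta> * 1 < \<beta> * p" using assms by (intro mult_strict_left_mono) auto
  then have "\<beta> < Q" using assms(5) by linarith
  have "0 < p" using assms(1) by simp
  obtain C1 where "0 < C1" and C1: "\<forall>F x r z a (b::'a). 0 < r \<longrightarrow> dist x z = 3 * r \<longrightarrow> 5 * r \<le> dist a b \<longrightarrow> F \<subseteq> cball x r \<longrightarrow>
      riesz_capacity M \<beta> p F \<le> ennreal C1 * hajlasz_capacity M \<beta> p F (ball x (2 * r))"
    using riesz_capacity_le_hajlasz_capacity[OF assms(2) \<open>\<beta> < Q\<close> \<open>0 < p\<close>] by (elim exE conjE) rule
  obtain C2 where C2: "0 < C2" "\<And>F x r. 0 < r \<Longrightarrow> closed F \<Longrightarrow> F \<subseteq> cball x r \<Longrightarrow>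
      hajlasz_capacity M \<beta> p F (ball x (2 * r)) \<le> ennreal C2 * riesz_capacity M \<beta> p F"
    using hajlasz_capacity_le_riesz_capacity[OF assms(1-3,5)] by blast
  define C where "C = max C1 C2"
  have C: "0 < C" using \<open>0 < C1\<close> by (simp add: C_def)
  have "ennreal (inverse C) * riesz_capacity M \<beta> p (E \<inter> closure (ball x r))
        \<le> hajlasz_capacity M \<beta> p (E \<inter> closure (ball x r)) (ball x (2 * r))"
      "hajlasz_capacity M \<beta> p (E \<inter> closure (ball x r)) (ball x (2 * r))
        \<le> ennreal C * riesz_capacity M \<beta> p (E \<inter> closure (ball x r))"
    if H: "closed E" "0 < r" "ennreal r < (1 / 8) * ediameter (UNIV :: 'a set)" for E x r
  proof -
    let ?F = "E \<inter> closure (ball x r)"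
    have F: "closed ?F" "?F \<subseteq> cball x r"
      using H(1) closure_minimal[of "ball x r" "cball x r"] by auto
    have "ennreal (8 * r) < ediameter (UNIV :: 'a set)"
    proof (cases "ediameter (UNIV :: 'a set)")
      case (real \<delta>)
      have "(1 / 8 :: ennreal) = ennreal (1 / 8)" using divide_ennreal[of 1 8] by simp
      then have "ennreal r < ennreal (1 / 8) * ennreal \<delta>" using H(3) real by simp
      also have "\<dots> = ennreal (1 / 8 * \<delta>)" using real by (intro ennreal_mult[symmetric]) auto
      finally have "ennreal r < ennreal (1 / 8 * \<delta>)" .
      then show ?thesis using real H(2) by (simp add: ennreal_less_iff)
    qed simp
    then obtain a b :: 'a where ab: "8 * r < dist a b" using ediameter_gtD[of "8 * r"] H(2) by auto
    \<comment> \<open>Points more than 8 r apart cannot both be within 4 r of x. A point farther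
      than 4 r yields z at distance 3 r by connectedness, and \<open>dist a b\<close> also exceeds 5
      r, the largest radius in the chain of balls.\<close>
    then have "4 * r < dist x a \<or> 4 * r < dist x b" using dist_triangle3[of a b x] by linarith
    then obtain e where "4 * r < dist x e" by blast
    then obtain z where z: "dist x z = 3 * r"
      using connected_exists_dist_eq[OF assms(9), of "3 * r" x e] H(2) by auto
    have "riesz_capacity M \<beta> p ?F \<le> ennreal C1 * hajlasz_capacity M \<beta> p ?F (ball x (2 * r))"
    proof (intro C1[rule_format])
      show "5 * r \<le> dist a b" using ab H(2) by simp
    qed (use H z F in auto)
    also have "\<dots> \<le> ennreal C * hajlasz_capacity M \<beta> p ?F (ball x (2 * r))"
      by (intro mult_right_mono ennreal_leI) (auto simp: C_def)
    finally have "ennreal (inverse C) * riesz_capacity M \<beta> p ?F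
        \<le> ennreal (inverse C) * (ennreal C * hajlasz_capacity M \<beta> p ?F (ball x (2 * r)))"
      by (intro mult_left_mono) auto
    then show "ennreal (inverse C) * riesz_capacity M \<beta> p ?F \<le> hajlasz_capacity M \<beta> p ?F (ball x (2 * r))"
      by (simp only: ennreal_inverse_cancel(1)[OF C])
    have "hajlasz_capacity M \<beta> p ?F (ball x (2 * r)) \<le> ennreal C2 * riesz_capacity M \<beta> p ?F"
      by (rule C2(2)[OF H(2) F])
    also have "\<dots> \<le> ennreal C * riesz_capacity M \<beta> p ?F"
      by (intro mult_right_mono ennreal_leI) (auto simp: C_def)
    finally show "hajlasz_capacity M \<beta> p ?F (ball x (2 * r)) \<le> ennreal C * riesz_capacity M \<beta> p ?F" .
  qed
  then show ?thesis using C by blast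
qed

end
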